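(* For every integer $k>1$, an optimal (minimum-cost) $k$-anonymization of a database with $n$ rows can be computed in $O(4^n\,\mathrm{poly}(n))$ time.
   Context: A database with $n$ rows over a finite alphabet $\Sigma$ is a matrix in $\Sigma^{n\times m}$. It is $k$-anonymous if every row is identical to at least $k-1$ other rows. A $k$-anonymization (suppression model) replaces some entries by a symbol $\star\notin\Sigma$ to make the database $k$-anonymous; its cost is the number of $\star$'s introduced. $\mathrm{poly}(n)$ denotes a quantity polynomial in $n$.
   Formalization: The time bound carries an extra factor polynomial in the number of columns m and in log|Σ|, since no bound in n alone can hold for all m; if no k-anonymization exists (0 < n < k), only halting within the time bound is claimed. *)

theory Defs
  imports
    "Jordan_Normal_Form.Matrix"
    "HOL-Computational_Algebra.Polynomial"
    "HOL-Library.Log_Nat"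
begin

section \<open>Anonymization by suppression\<close>

text \<open>An entry of an anonymized database over \<open>'a\<close> has type \<open>'a option\<close>; the suppression symbol
  \<open>\<star>\<close> is \<^const>\<open>None\<close>, so it is never a letter and two suppressed entries are equal.\<close>

definition k_anonymous :: "nat \<Rightarrow> 'b mat \<Rightarrow> bool" where
  "k_anonymous k B \<longleftrightarrow>
     (\<forall>i < dim_row B. card {j. j < dim_row B \<and> j \<noteq> i \<and> row B j = row B i} \<ge> k - 1)"

definition suppression :: "'a mat \<Rightarrow> 'a option mat \<Rightarrow> bool" where
  "suppression D B \<longleftrightarrow> B \<in> carrier_mat (dim_row D) (dim_col D) \<and>
     (\<forall>i < dim_row D. \<forall>j < dim_col D. B $$ (i, j) = Some (D $$ (i, j)) \<or> B $$ (i, j) = None)"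

definition k_anonymization :: "nat \<Rightarrow> 'a mat \<Rightarrow> 'a option mat \<Rightarrow> bool" where
  "k_anonymization k D B \<longleftrightarrow> suppression D B \<and> k_anonymous k B"

definition anon_cost :: "'a option mat \<Rightarrow> nat" where
  "anon_cost B = card {(i, j). i < dim_row B \<and> j < dim_col B \<and> B $$ (i, j) = None}"

definition optimal_k_anonymization :: "nat \<Rightarrow> 'a mat \<Rightarrow> 'a option mat \<Rightarrow> bool" where
  "optimal_k_anonymization k D B \<longleftrightarrow> is_arg_min anon_cost (k_anonymization k D) B"

section \<open>Random access machines with logarithmic cost\<close>

text \<open>The machine is a random access machine after Aho, Hopcroft and Ullman under the logarithmic
  cost criterion, with structured control flow in place of jumps. A program uses finitely many
  scalar registers and finitely many arrays of unbounded length, both numbered by naturals; every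
  cell holds a natural number of unbounded size, subtraction is truncated and division is integer
  division. Array cells are addressed by computed indices.\<close>

datatype expr =
    Const nat
  | Reg nat
  | Arr nat expr
  | Plus expr expr
  | Minus expr expr
  | Times expr expr
  | Quot expr expr

datatype prog =
    Skip
  | Assign nat expr
  | Store nat expr expr  \<comment> \<open>array, index, value\<close>
  | Seq prog prog
  | Cond expr prog prog  \<comment> \<open>guards of \<open>Cond\<close> and \<open>While\<close> are tested for being nonzero\<close>
  | While expr prog

record state =
  regs :: "nat \<Rightarrow> nat"
  arrs :: "nat \<Rightarrow> nat \<Rightarrow> nat"

fun val :: "expr \<Rightarrow> state \<Rightarrow> nat" where
  "val (Const c) s = c"
| "val (Reg r) s = regs s r"
| "val (Arr a e) s = arrs s a (val e s)"
| "val (Plus e f) s = val e s + val f s"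
| "val (Minus e f) s = val e s - val f s"
| "val (Times e f) s = val e s * val f s"
| "val (Quot e f) s = val e s div val f s"

definition size_of :: "nat \<Rightarrow> nat" where
  "size_of x = max 1 (floorlog 2 x)"

text \<open>Evaluating an expression costs the binary length of the value of each of its subexpressions;
  this charges for all operands, results and array indices.\<close>

fun ecost :: "expr \<Rightarrow> state \<Rightarrow> nat" where
  "ecost (Const c) s = size_of c"
| "ecost (Reg r) s = size_of (regs s r)"
| "ecost (Arr a e) s = ecost e s + size_of (val (Arr a e) s)"
| "ecost (Plus e f) s = ecost e s + ecost f s + size_of (val (Plus e f) s)"
| "ecost (Minus e f) s = ecost e s + ecost f s + size_of (val (Minus e f) s)"
| "ecost (Times e f) s = ecost e s + ecost f s + size_of (val (Times e f) s)"
| "ecost (Quot e f) s = ecost e s + ecost f s + size_of (val (Quot e f) s)"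

text \<open>\<open>runs P s t s'\<close>: started in \<open>s\<close>, the program \<open>P\<close> halts in \<open>s'\<close> after time \<open>t\<close>.\<close>

inductive runs :: "prog \<Rightarrow> state \<Rightarrow> nat \<Rightarrow> state \<Rightarrow> bool" where
  Skip: "runs Skip s 1 s"
| Assign: "runs (Assign r e) s (1 + ecost e s) (s\<lparr>regs := (regs s)(r := val e s)\<rparr>)"
| Store: "runs (Store a e f) s (1 + ecost e s + ecost f s)
            (s\<lparr>arrs := (arrs s)(a := (arrs s a)(val e s := val f s))\<rparr>)"
| Seq: "runs P s t s' \<Longrightarrow> runs Q s' u s'' \<Longrightarrow> runs (Seq P Q) s (t + u) s''"
| CondT: "val e s \<noteq> 0 \<Longrightarrow> runs P s t s' \<Longrightarrow> runs (Cond e P Q) s (1 + ecost e s + t) s'"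
| CondF: "val e s = 0 \<Longrightarrow> runs Q s t s' \<Longrightarrow> runs (Cond e P Q) s (1 + ecost e s + t) s'"
| WhileF: "val e s = 0 \<Longrightarrow> runs (While e P) s (1 + ecost e s) s"
| WhileT: "val e s \<noteq> 0 \<Longrightarrow> runs P s t s' \<Longrightarrow> runs (While e P) s' u s'' \<Longrightarrow>
             runs (While e P) s (1 + ecost e s + t + u) s''"

inductive_cases SkipE: "runs Skip s t s'"
inductive_cases AssignE: "runs (Assign r e) s t s'"
inductive_cases StoreE: "runs (Store a e f) s t s'"
inductive_cases SeqE: "runs (Seq P Q) s t s'"
inductive_cases CondE: "runs (Cond e P Q) s t s'"
inductive_cases WhileE: "runs (While e P) s t s'"

lemma runs_deterministic:
  "runs P s t s' \<Longrightarrow> runs P s u s'' \<Longrightarrow> t = u \<and> s' = s''"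
proof (induction arbitrary: u s'' rule: runs.induct)
  case (Skip s)
  then show ?case by (elim SkipE) simp
next
  case (Assign r e s)
  then show ?case by (elim AssignE) simp
next
  case (Store a e f s)
  then show ?case by (elim StoreE) simp
next
  case (Seq P s t s' Q v s2)
  from Seq.prems obtain t' s1 v' where "runs P s t' s1" "runs Q s1 v' s''" "u = t' + v'"
    by (elim SeqE)
  with Seq.IH(1)[of t' s1] Seq.IH(2)[of v' s''] show ?case by simp
next
  case (CondT e s P t s' Q)
  show ?case
  proof (rule CondE[OF CondT.prems])
    fix t'
    assume "u = Suc (ecost e s + t')" "runs P s t' s''"
    with CondT.IH[of t' s''] show ?thesis by simp
  qed (use CondT.hyps in simp)
next
  case (CondF e s Q t s' P)
  show ?case
  proof (rule CondE[OF CondF.prems])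
    fix t'
    assume "u = Suc (ecost e s + t')" "runs Q s t' s''"
    with CondF.IH[of t' s''] show ?thesis by simp
  qed (use CondF.hyps in simp)
next
  case (WhileF e s P)
  show ?case
    by (rule WhileE[OF WhileF.prems]) (use WhileF.hyps in simp_all)
next
  case (WhileT e s P t s' v s2)
  show ?case
  proof (rule WhileE[OF WhileT.prems])
    fix t' s1 v'
    assume "u = Suc (ecost e s + t' + v')" "runs P s t' s1" "runs (While e P) s1 v' s''"
    with WhileT.IH(1)[of t' s1] WhileT.IH(2)[of v' s''] show ?thesis by simp
  qed (use WhileT.hyps in simp)
qed

section \<open>Input and output\<close>

fun code :: "nat option \<Rightarrow> nat" where
  "code None = 0"
| "code (Some a) = Suc a"

text \<open>Registers 0 and 1 initially hold the numbers of rows and columns, array 0 holds the entries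
  in row-major order, and all other cells are 0. The result is read off array 1, in the same
  layout.\<close>

definition input_state :: "nat mat \<Rightarrow> state" where
  "input_state D =
     \<lparr>regs = (\<lambda>r. if r = 0 then dim_row D else if r = 1 then dim_col D else 0),
      arrs = (\<lambda>a l. if a = 0 \<and> l < dim_row D * dim_col D
                     then code (Some (D $$ (l div dim_col D, l mod dim_col D))) else 0)\<rparr>"

definition outputs :: "state \<Rightarrow> nat option mat \<Rightarrow> bool" where
  "outputs s B \<longleftrightarrow>
     (\<forall>i < dim_row B. \<forall>j < dim_col B. arrs s 1 (i * dim_col B + j) = code (B $$ (i, j)))"

text \<open>A \<open>k\<close>-anonymization need not exist (when \<open>0 < n < k\<close>); the program must then
  still halt, but its output is unconstrained.\<close>

definition computes_within :: "prog \<Rightarrow> nat \<Rightarrow> nat mat \<Rightarrow> nat \<Rightarrow> bool" where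
  "computes_within P k D T \<longleftrightarrow>
     (\<exists>t s. runs P (input_state D) t s \<and> t \<le> T \<and>
        ((\<exists>B. k_anonymization k D B) \<longrightarrow> (\<exists>B. optimal_k_anonymization k D B \<and> outputs s B)))"

end

theory Submission
  imports Defs "HOL-Library.Nat_Bijection"
begin

text \<open>Rows may be grouped arbitrarily into blocks of size at least \<open>k\<close>; a block \<open>T\<close> then costs \<open>card T\<close>
  times the number of columns that are not constant on \<open>T\<close>. Conversely, the classes of equal rows of
  any anonymization form such a grouping of no larger cost. The optimal grouping is found by dynamic
  programming over the sets \<open>S\<close> of rows already grouped: all pairs of \<open>S\<close> and a next block \<open>T\<close> are
  tried, which gives the factor \<open>4 ^ n\<close>.

  The machine program is compiled from expressions with bounded sums, products and maxima. These have
  no loop-carried state, so bounds for all intermediate values, and hence the logarithmic cost, can be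
  computed by recursion on the syntax.\<close>

section \<open>Expressions with bounded folds\<close>

text \<open>A block of at least \<open>k > 0\<close> rows has a positive code, so the recurrence for
  \<open>S\<close> reads only entries \<open>S + T\<close> above \<open>S\<close>, and loops that
  count down fill the table in a correct order. The value \<open>n * m + 1\<close> of the full set
  exceeds every possible cost by one; hence a groupable set keeps a positive entry, and a positive
  entry never stems from a truncated subtraction. Optimality splits in two: every grouping bounds
  the table from one side, and the reconstructed list of blocks attains this bound exactly. The time
  bound is a product: the number of elementary steps, with two factors \<open>2 ^ n\<close>, times a
  bound on the lengths of all values, which is polynomial. Syntactic bounds on values may be very
  crude, because only their lengths count and the length of a product is at most the sum of the
  lengths. Loop limits also enter the number of steps, so they must be bounded tightly; they are
  only \<open>n\<close>, \<open>m\<close> and (up to one) \<open>2 ^ n\<close>.\<close>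

datatype binop = Add | Sub | Mul | Div

datatype agg = Sum | Prod | Maximum

datatype hexp =
    Num nat
  | Var nat
  | Cell nat hexp
  | Bin binop hexp hexp
  | Fold agg nat hexp hexp

datatype hprog =
    Put nat hexp hexp
  | Then hprog hprog
  | Bind nat hexp hprog
  | For nat hexp hprog

fun op_val :: "binop \<Rightarrow> nat \<Rightarrow> nat \<Rightarrow> nat" where
  "op_val Add x y = x + y"
| "op_val Sub x y = x - y"
| "op_val Mul x y = x * y"
| "op_val Div x y = x div y"

fun op_expr :: "binop \<Rightarrow> expr \<Rightarrow> expr \<Rightarrow> expr" where
  "op_expr Add = Plus"
| "op_expr Sub = Minus"
| "op_expr Mul = Times"
| "op_expr Div = Quot"

fun op_bound :: "binop \<Rightarrow> nat \<Rightarrow> nat \<Rightarrow> nat" where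
  "op_bound Add x y = x + y"
| "op_bound Sub x y = x"
| "op_bound Mul x y = x * y"
| "op_bound Div x y = x"

fun agg_init :: "agg \<Rightarrow> nat" where
  "agg_init Sum = 0"
| "agg_init Prod = 1"
| "agg_init Maximum = 0"

fun agg_val :: "agg \<Rightarrow> nat \<Rightarrow> nat \<Rightarrow> nat" where
  "agg_val Sum x y = x + y"
| "agg_val Prod x y = x * y"
| "agg_val Maximum x y = max x y"

text \<open>The machine has no maximum, but with truncated subtraction \<open>x + (y - x)\<close> is
  one. Its five subexpressions are the origin of the factor 5 in
  \<open>agg_expr_cost\<close>.\<close>

fun agg_expr :: "agg \<Rightarrow> expr \<Rightarrow> expr \<Rightarrow> expr" where
  "agg_expr Sum x y = Plus x y"
| "agg_expr Prod x y = Times x y"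
| "agg_expr Maximum x y = Plus x (Minus y x)"

text \<open>\<open>N\<close> is only an upper bound on the number of terms, so the base of the power
  is raised to at least 1; otherwise shorter and empty products would not be covered.\<close>

fun agg_bound :: "agg \<Rightarrow> nat \<Rightarrow> nat \<Rightarrow> nat" where
  "agg_bound Sum N b = N * b"
| "agg_bound Prod N b = max 1 b ^ N"
| "agg_bound Maximum N b = b"

fun aggregate :: "agg \<Rightarrow> (nat \<Rightarrow> nat) \<Rightarrow> nat set \<Rightarrow> nat" where
  "aggregate Sum h A = sum h A"
| "aggregate Prod h A = prod h A"
| "aggregate Maximum h A = Max (insert 0 (h ` A))"

fun den :: "hexp \<Rightarrow> (nat \<Rightarrow> nat) \<Rightarrow> (nat \<Rightarrow> nat \<Rightarrow> nat) \<Rightarrow> nat" where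
  "den (Num c) \<rho> A = c"
| "den (Var x) \<rho> A = \<rho> x"
| "den (Cell a e) \<rho> A = A a (den e \<rho> A)"
| "den (Bin b e f) \<rho> A = op_val b (den e \<rho> A) (den f \<rho> A)"
| "den (Fold g x e f) \<rho> A = aggregate g (\<lambda>i. den f (\<rho>(x := i)) A) {..<den e \<rho> A}"

text \<open>Indices descend because one register is both loop counter and index variable, and
  because larger sets must enter the table before smaller ones.\<close>

primrec countdown :: "(nat \<Rightarrow> 'a \<Rightarrow> 'a) \<Rightarrow> nat \<Rightarrow> 'a \<Rightarrow> 'a" where
  "countdown h 0 z = z"
| "countdown h (Suc i) z = countdown h i (h i z)"

fun hsem :: "hprog \<Rightarrow> (nat \<Rightarrow> nat) \<Rightarrow> (nat \<Rightarrow> nat \<Rightarrow> nat) \<Rightarrow> (nat \<Rightarrow> nat \<Rightarrow> nat)" where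
  "hsem (Put a e f) \<rho> A = A(a := (A a)(den e \<rho> A := den f \<rho> A))"
| "hsem (Then P Q) \<rho> A = hsem Q \<rho> (hsem P \<rho> A)"
| "hsem (Bind x e P) \<rho> A = hsem P (\<rho>(x := den e \<rho> A)) A"
| "hsem (For x e P) \<rho> A = countdown (\<lambda>i. hsem P (\<rho>(x := i))) (den e \<rho> A) A"

section \<open>Compilation\<close>

text \<open>\<open>\<Gamma>\<close> assigns a register to each variable. The value ends up in register \<open>d\<close>, and the
  registers below \<open>d\<close> are left alone.\<close>

fun compile :: "(nat \<Rightarrow> nat) \<Rightarrow> nat \<Rightarrow> hexp \<Rightarrow> prog" where
  "compile \<Gamma> d (Num c) = Assign d (Const c)"
| "compile \<Gamma> d (Var x) = Assign d (Reg (\<Gamma> x))"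
| "compile \<Gamma> d (Cell a e) = Seq (compile \<Gamma> d e) (Assign d (Arr a (Reg d)))"
| "compile \<Gamma> d (Bin b e f) = Seq (compile \<Gamma> d e)
     (Seq (compile \<Gamma> (Suc d) f) (Assign d (op_expr b (Reg d) (Reg (Suc d)))))"
| "compile \<Gamma> d (Fold g x e f) = Seq (compile \<Gamma> d e) (Seq (Assign (Suc d) (Const (agg_init g)))
     (Seq (While (Reg d) (Seq (Assign d (Minus (Reg d) (Const 1)))
            (Seq (compile (\<Gamma>(x := d)) (Suc (Suc d)) f)
              (Assign (Suc d) (agg_expr g (Reg (Suc d)) (Reg (Suc (Suc d))))))))
          (Assign d (Reg (Suc d)))))"

fun compile_prog :: "(nat \<Rightarrow> nat) \<Rightarrow> nat \<Rightarrow> hprog \<Rightarrow> prog" where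
  "compile_prog \<Gamma> d (Put a e f) =
     Seq (compile \<Gamma> d e) (Seq (compile \<Gamma> (Suc d) f) (Store a (Reg d) (Reg (Suc d))))"
| "compile_prog \<Gamma> d (Then P Q) = Seq (compile_prog \<Gamma> d P) (compile_prog \<Gamma> d Q)"
| "compile_prog \<Gamma> d (Bind x e P) = Seq (compile \<Gamma> d e) (compile_prog (\<Gamma>(x := d)) (Suc d) P)"
| "compile_prog \<Gamma> d (For x e P) = Seq (compile \<Gamma> d e)
     (While (Reg d) (Seq (Assign d (Minus (Reg d) (Const 1)))
        (compile_prog (\<Gamma>(x := d)) (Suc d) P)))"

text \<open>Given bounds \<open>\<beta>\<close> on the variables and \<open>\<alpha>\<close> on the array cells, values, binary lengths and
  numbers of elementary steps are bounded by recursion on the syntax.\<close>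

fun bound :: "hexp \<Rightarrow> (nat \<Rightarrow> nat) \<Rightarrow> (nat \<Rightarrow> nat) \<Rightarrow> nat" where
  "bound (Num c) \<beta> \<alpha> = c"
| "bound (Var x) \<beta> \<alpha> = \<beta> x"
| "bound (Cell a e) \<beta> \<alpha> = \<alpha> a"
| "bound (Bin b e f) \<beta> \<alpha> = op_bound b (bound e \<beta> \<alpha>) (bound f \<beta> \<alpha>)"
| "bound (Fold g x e f) \<beta> \<alpha> = agg_bound g (bound e \<beta> \<alpha>) (bound f (\<beta>(x := bound e \<beta> \<alpha>)) \<alpha>)"

fun bits :: "hexp \<Rightarrow> (nat \<Rightarrow> nat) \<Rightarrow> (nat \<Rightarrow> nat) \<Rightarrow> nat" where
  "bits (Num c) \<beta> \<alpha> = size_of c"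
| "bits (Var x) \<beta> \<alpha> = size_of (\<beta> x)"
| "bits (Cell a e) \<beta> \<alpha> = bits e \<beta> \<alpha> + size_of (\<alpha> a)"
| "bits (Bin b e f) \<beta> \<alpha> =
     bits e \<beta> \<alpha> + bits f \<beta> \<alpha> + size_of (bound (Bin b e f) \<beta> \<alpha>)"
| "bits (Fold g x e f) \<beta> \<alpha> = bits e \<beta> \<alpha> + bits f (\<beta>(x := bound e \<beta> \<alpha>)) \<alpha> +
     size_of (bound (Fold g x e f) \<beta> \<alpha>)"

fun steps :: "hexp \<Rightarrow> (nat \<Rightarrow> nat) \<Rightarrow> (nat \<Rightarrow> nat) \<Rightarrow> nat" where
  "steps (Num c) \<beta> \<alpha> = 1"
| "steps (Var x) \<beta> \<alpha> = 1"
| "steps (Cell a e) \<beta> \<alpha> = steps e \<beta> \<alpha> + 1"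
| "steps (Bin b e f) \<beta> \<alpha> = steps e \<beta> \<alpha> + steps f \<beta> \<alpha> + 1"
| "steps (Fold g x e f) \<beta> \<alpha> =
     steps e \<beta> \<alpha> + 3 + bound e \<beta> \<alpha> * (steps f (\<beta>(x := bound e \<beta> \<alpha>)) \<alpha> + 3)"

text \<open>The bound of an array applies to all its cells, so it is invariant as soon as every
  stored value respects it; the index of a store needs no check.\<close>

fun well_bounded :: "hprog \<Rightarrow> (nat \<Rightarrow> nat) \<Rightarrow> (nat \<Rightarrow> nat) \<Rightarrow> bool" where
  "well_bounded (Put a e f) \<beta> \<alpha> \<longleftrightarrow> bound f \<beta> \<alpha> \<le> \<alpha> a"
| "well_bounded (Then P Q) \<beta> \<alpha> \<longleftrightarrow> well_bounded P \<beta> \<alpha> \<and> well_bounded Q \<beta> \<alpha>"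
| "well_bounded (Bind x e P) \<beta> \<alpha> \<longleftrightarrow> well_bounded P (\<beta>(x := bound e \<beta> \<alpha>)) \<alpha>"
| "well_bounded (For x e P) \<beta> \<alpha> \<longleftrightarrow> well_bounded P (\<beta>(x := bound e \<beta> \<alpha>)) \<alpha>"

fun prog_bits :: "hprog \<Rightarrow> (nat \<Rightarrow> nat) \<Rightarrow> (nat \<Rightarrow> nat) \<Rightarrow> nat" where
  "prog_bits (Put a e f) \<beta> \<alpha> = bits e \<beta> \<alpha> + bits f \<beta> \<alpha>"
| "prog_bits (Then P Q) \<beta> \<alpha> = prog_bits P \<beta> \<alpha> + prog_bits Q \<beta> \<alpha>"
| "prog_bits (Bind x e P) \<beta> \<alpha> = bits e \<beta> \<alpha> + prog_bits P (\<beta>(x := bound e \<beta> \<alpha>)) \<alpha>"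
| "prog_bits (For x e P) \<beta> \<alpha> = bits e \<beta> \<alpha> + prog_bits P (\<beta>(x := bound e \<beta> \<alpha>)) \<alpha>"

fun prog_steps :: "hprog \<Rightarrow> (nat \<Rightarrow> nat) \<Rightarrow> (nat \<Rightarrow> nat) \<Rightarrow> nat" where
  "prog_steps (Put a e f) \<beta> \<alpha> = steps e \<beta> \<alpha> + steps f \<beta> \<alpha> + 1"
| "prog_steps (Then P Q) \<beta> \<alpha> = prog_steps P \<beta> \<alpha> + prog_steps Q \<beta> \<alpha>"
| "prog_steps (Bind x e P) \<beta> \<alpha> = steps e \<beta> \<alpha> + prog_steps P (\<beta>(x := bound e \<beta> \<alpha>)) \<alpha>"
| "prog_steps (For x e P) \<beta> \<alpha> =
     steps e \<beta> \<alpha> + 1 + bound e \<beta> \<alpha> * (prog_steps P (\<beta>(x := bound e \<beta> \<alpha>)) \<alpha> + 2)"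

section \<open>Correctness of compilation\<close>

lemma size_of_mono: "x \<le> y \<Longrightarrow> size_of x \<le> size_of y"
  using floorlog_mono[of x y 2] by (simp add: size_of_def)

lemma size_of_ge_1: "1 \<le> size_of x"
  by (simp add: size_of_def)

lemma size_of_0_1 [simp]: "size_of 0 = 1" "size_of (Suc 0) = 1"
  by (simp_all add: size_of_def floorlog_def)

lemma aggregate_insert:
  "finite A \<Longrightarrow> i \<notin> A \<Longrightarrow> aggregate g h (insert i A) = agg_val g (aggregate g h A) (h i)"
proof (cases g)
  case Maximum
  assume "finite A"
  then have "Max (insert (h i) (insert 0 (h ` A))) = max (h i) (Max (insert 0 (h ` A)))"
    by (intro Max_insert) auto
  with Maximum show ?thesis by (simp add: insert_commute max.commute)
qed (auto simp: ac_simps)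

lemma aggregate_empty: "aggregate g h {} = agg_init g"
  by (cases g) auto

lemma aggregate_le:
  assumes "finite A" "\<And>i. i \<in> A \<Longrightarrow> h i \<le> b" "card A \<le> N"
  shows "aggregate g h A \<le> agg_bound g N b"
proof (cases g)
  case Sum
  have "sum h A \<le> of_nat (card A) * b" by (rule sum_bounded_above) (use assms in auto)
  also have "\<dots> \<le> N * b" using assms(3) by simp
  finally show ?thesis using Sum by simp
next
  case Prod
  have "prod h A \<le> (\<Prod>i\<in>A. max 1 b)" by (rule prod_mono) (use assms in \<open>auto simp: le_max_iff_disj\<close>)
  also have "\<dots> \<le> max 1 b ^ N" using assms(3) by (simp add: power_increasing)
  finally show ?thesis using Prod by simp
next
  case Maximum
  then show ?thesis using assms by auto
qed

lemma op_val_le: "x \<le> x' \<Longrightarrow> y \<le> y' \<Longrightarrow> op_val b x y \<le> op_bound b x' y'"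
proof (cases b)
  case Div
  assume "x \<le> x'"
  then show ?thesis using Div le_trans[OF div_le_dividend[of x y]] by simp
qed (auto intro: mult_le_mono)

lemma den_le_bound:
  assumes "\<And>x. \<rho> x \<le> \<beta> x" "\<And>a l. A a l \<le> \<alpha> a"
  shows "den e \<rho> A \<le> bound e \<beta> \<alpha>"
  using assms(1)
proof (induction e arbitrary: \<rho> \<beta>)
  case (Bin b e f)
  then show ?case by (simp add: op_val_le)
next
  case (Fold g x e f)
  have e: "den e \<rho> A \<le> bound e \<beta> \<alpha>" by (rule Fold) (rule Fold)
  have "den f (\<rho>(x := i)) A \<le> bound f (\<beta>(x := bound e \<beta> \<alpha>)) \<alpha>" if "i < den e \<rho> A" for i
    by (rule Fold) (use Fold.prems that e in auto)
  then show ?case using e by (auto intro!: aggregate_le)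
qed (auto simp: assms(2))

section \<open>Total-correctness triples with a time budget\<close>

definition exec :: "prog \<Rightarrow> state \<Rightarrow> nat \<Rightarrow> (state \<Rightarrow> bool) \<Rightarrow> bool" where
  "exec P s T Q \<longleftrightarrow> (\<exists>t s'. runs P s t s' \<and> t \<le> T \<and> Q s')"

lemma exec_mono:
  "exec P s T Q \<Longrightarrow> T \<le> T' \<Longrightarrow> (\<And>s'. Q s' \<Longrightarrow> Q' s') \<Longrightarrow> exec P s T' Q'"
  unfolding exec_def using order_trans by blast

lemma exec_Assign:
  "1 + ecost e s \<le> T \<Longrightarrow> Q (s\<lparr>regs := (regs s)(r := val e s)\<rparr>) \<Longrightarrow> exec (Assign r e) s T Q"
  unfolding exec_def using runs.Assign by blast

lemma exec_Store:
  "1 + ecost e s + ecost f s \<le> T \<Longrightarrow>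
   Q (s\<lparr>arrs := (arrs s)(a := (arrs s a)(val e s := val f s))\<rparr>) \<Longrightarrow> exec (Store a e f) s T Q"
  unfolding exec_def using runs.Store by blast

lemma exec_Seq:
  assumes "exec P s T R" "\<And>s'. R s' \<Longrightarrow> exec Q s' T' Z" "T + T' \<le> T''"
  shows "exec (Seq P Q) s T'' Z"
proof -
  obtain t s' where 1: "runs P s t s'" "t \<le> T" "R s'" using assms(1) unfolding exec_def by auto
  obtain u s'' where 2: "runs Q s' u s''" "u \<le> T'" "Z s''"
    using assms(2)[OF 1(3)] unfolding exec_def by auto
  have "runs (Seq P Q) s (t + u) s''" by (rule runs.Seq) fact+
  moreover have "t + u \<le> T''" using 1 2 assms(3) by linarith
  ultimately show ?thesis using 2 unfolding exec_def by blast
qed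

text \<open>\<open>I i\<close> is the invariant when \<open>i\<close> iterations remain. The amount
  \<open>c\<close> pays for one test of the guard, and there are \<open>N + 1\<close> tests.\<close>

lemma exec_countdown:
  assumes "I N s" "\<And>i s. I i s \<Longrightarrow> regs s d = i"
    and "\<And>i s. i < N \<Longrightarrow> I (Suc i) s \<Longrightarrow> exec P s T (I i)"
    and "1 + size_of N \<le> c"
  shows "exec (While (Reg d) P) s (N * (T + c) + c) (I 0)"
  using assms(1,3,4)
proof (induction N arbitrary: s)
  case 0
  then have "runs (While (Reg d) P) s (1 + ecost (Reg d) s) s"
    by (intro runs.WhileF) (simp add: assms(2))
  then show ?case using 0 assms(2)[OF 0(1)] unfolding exec_def by fastforce
next
  case (Suc N)
  have r: "regs s d = Suc N" using Suc.prems(1) assms(2) by simp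
  obtain t s' where 1: "runs P s t s'" "t \<le> T" "I N s'"
    using Suc.prems(2)[of N s] Suc.prems(1) unfolding exec_def by auto
  have c: "1 + size_of N \<le> c" using Suc.prems(3) size_of_mono[of N "Suc N"] by simp
  obtain u s'' where 2: "runs (While (Reg d) P) s' u s''" "u \<le> N * (T + c) + c" "I 0 s''"
    using Suc.IH[OF 1(3) Suc.prems(2)[OF less_SucI] c] unfolding exec_def by auto
  have "runs (While (Reg d) P) s (1 + ecost (Reg d) s + t + u) s''"
    by (rule runs.WhileT) (use r 1 2 in auto)
  moreover have "1 + ecost (Reg d) s + t + u \<le> Suc N * (T + c) + c"
    using Suc.prems(3) r 1 2 by simp
  ultimately show ?case using 2 unfolding exec_def by blast
qed

lemma agg_expr_val: "val (agg_expr g e f) s = agg_val g (val e s) (val f s)"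
  by (cases g) auto

lemma op_expr_val: "val (op_expr b e f) s = op_val b (val e s) (val f s)"
  by (cases b) auto

lemma agg_expr_cost:
  assumes "size_of (regs s r) \<le> L" "size_of (regs s r') \<le> L"
    "size_of (agg_val g (regs s r) (regs s r')) \<le> L"
  shows "ecost (agg_expr g (Reg r) (Reg r')) s \<le> 5 * L"
proof -
  have "size_of (regs s r' - regs s r) \<le> L"
    using assms(2) size_of_mono[of "regs s r' - regs s r" "regs s r'"] by linarith
  moreover have "regs s r + (regs s r' - regs s r) = max (regs s r) (regs s r')" by simp
  ultimately show ?thesis using assms by (cases g) auto
qed

lemma op_expr_cost:
  assumes "size_of (regs s r) \<le> L" "size_of (regs s r') \<le> L"
    "size_of (op_val b (regs s r) (regs s r')) \<le> L"
  shows "ecost (op_expr b (Reg r) (Reg r')) s \<le> 3 * L"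
  using assms by (cases b) auto

lemma bound_le_bits: "size_of (bound e \<beta> \<alpha>) \<le> bits e \<beta> \<alpha>"
  by (cases e) auto

lemma bits_ge_1: "1 \<le> bits e \<beta> \<alpha>"
  using bound_le_bits size_of_ge_1 order_trans by blast

text \<open>An elementary step costs at most \<open>6 * L\<close>: one unit plus at most five
  subexpressions (reached by a maximum), each of length at most \<open>L\<close>. Any
  \<open>L\<close> above \<open>bits\<close> is allowed, so that all subexpressions share the same
  \<open>L\<close>.\<close>

lemma exec_compile:
  assumes "\<And>x. \<Gamma> x < d" "\<And>x. regs s (\<Gamma> x) \<le> \<beta> x" "\<And>a l. arrs s a l \<le> \<alpha> a"
    "bits e \<beta> \<alpha> \<le> L"
  shows "exec (compile \<Gamma> d e) s (steps e \<beta> \<alpha> * (6 * L))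
    (\<lambda>s'. arrs s' = arrs s \<and> (\<forall>r<d. regs s' r = regs s r) \<and>
          regs s' d = den e (\<lambda>x. regs s (\<Gamma> x)) (arrs s))"
  using assms
proof (induction e arbitrary: \<Gamma> d s \<beta>)
  case (Num c)
  then show ?case using size_of_ge_1[of c] by (auto intro!: exec_Assign)
next
  case (Var x)
  then show ?case using size_of_ge_1[of "\<beta> x"] size_of_mono[OF Var.prems(2)[of x]]
    by (auto intro!: exec_Assign)
next
  case (Cell a e)
  let ?v = "den e (\<lambda>x. regs s (\<Gamma> x)) (arrs s)"
  have v: "?v \<le> bound e \<beta> \<alpha>" by (intro den_le_bound Cell.prems)
  have L: "bits e \<beta> \<alpha> \<le> L" using Cell.prems by simp
  show ?case unfolding compile.simps
  proof (rule exec_Seq[OF Cell.IH[OF Cell.prems(1-3) L]])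
    fix s' :: state assume s': "arrs s' = arrs s \<and> (\<forall>r<d. regs s' r = regs s r) \<and> regs s' d = ?v"
    have "size_of ?v \<le> L" using size_of_mono[OF v] bound_le_bits[of e \<beta> \<alpha>] L by linarith
    moreover have "size_of (arrs s a ?v) \<le> L"
      using size_of_mono[OF Cell.prems(3)[of a ?v]] Cell.prems(4) by simp
    moreover have "1 \<le> L" using bits_ge_1[of e \<beta> \<alpha>] L by simp
    ultimately show "exec (Assign d (Arr a (Reg d))) s' (6 * L) (\<lambda>s'. arrs s' = arrs s \<and>
        (\<forall>r<d. regs s' r = regs s r) \<and> regs s' d = den (Cell a e) (\<lambda>x. regs s (\<Gamma> x)) (arrs s))"
      using s' by (intro exec_Assign) auto
  qed simp
next
  case (Bin b e f)
  let ?\<rho> = "\<lambda>x. regs s (\<Gamma> x)"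
  let ?v = "den e ?\<rho> (arrs s)" and ?w = "den f ?\<rho> (arrs s)"
  have v: "?v \<le> bound e \<beta> \<alpha>" "?w \<le> bound f \<beta> \<alpha>" by (intro den_le_bound Bin.prems)+
  have L: "bits e \<beta> \<alpha> \<le> L" "bits f \<beta> \<alpha> \<le> L" using Bin.prems by simp_all
  show ?case unfolding compile.simps
  proof (rule exec_Seq[OF Bin.IH(1)[OF Bin.prems(1-3) L(1)]])
    fix s' :: state assume s': "arrs s' = arrs s \<and> (\<forall>r<d. regs s' r = regs s r) \<and> regs s' d = ?v"
    have \<Gamma>: "\<And>x. \<Gamma> x < Suc d" "\<And>x. regs s' (\<Gamma> x) = regs s (\<Gamma> x)"
      using Bin.prems(1) s' less_SucI by blast+
    have 1: "exec (compile \<Gamma> (Suc d) f) s' (steps f \<beta> \<alpha> * (6 * L)) (\<lambda>s''. arrs s'' = arrs s \<and>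
      (\<forall>r<d. regs s'' r = regs s r) \<and> regs s'' d = ?v \<and> regs s'' (Suc d) = ?w)"
      by (rule exec_mono[OF Bin.IH(2)[where \<beta> = \<beta>]])
        (use \<Gamma> Bin.prems s' L in \<open>simp_all add: less_Suc_eq\<close>)
    show "exec (Seq (compile \<Gamma> (Suc d) f) (Assign d (op_expr b (Reg d) (Reg (Suc d))))) s'
      (steps f \<beta> \<alpha> * (6 * L) + 6 * L)
      (\<lambda>s'. arrs s' = arrs s \<and> (\<forall>r<d. regs s' r = regs s r) \<and>
          regs s' d = den (Bin b e f) ?\<rho> (arrs s))"
    proof (rule exec_Seq[OF 1 _ order_refl])
      fix s2 :: state assume s2: "arrs s2 = arrs s \<and> (\<forall>r<d. regs s2 r = regs s r) \<and> regs s2 d = ?v \<and>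
        regs s2 (Suc d) = ?w"
      have "size_of ?v \<le> L" "size_of ?w \<le> L"
        using size_of_mono[OF v(1)] bound_le_bits[of e \<beta> \<alpha>]
          size_of_mono[OF v(2)] bound_le_bits[of f \<beta> \<alpha>] L by linarith+
      moreover have "size_of (op_val b ?v ?w) \<le> L"
        using size_of_mono[OF op_val_le[OF v, of b]] Bin.prems(4) by simp
      ultimately have "ecost (op_expr b (Reg d) (Reg (Suc d))) s2 \<le> 3 * L"
        using s2 by (intro op_expr_cost) auto
      moreover have "1 \<le> L" using bits_ge_1[of e \<beta> \<alpha>] L by simp
      ultimately show "exec (Assign d (op_expr b (Reg d) (Reg (Suc d)))) s2 (6 * L)
        (\<lambda>s'. arrs s' = arrs s \<and> (\<forall>r<d. regs s' r = regs s r) \<and>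
          regs s' d = den (Bin b e f) ?\<rho> (arrs s))"
        using s2 by (intro exec_Assign) (auto simp: op_expr_val)
    qed
  qed (simp add: algebra_simps)
next
  case (Fold g x e f)
  let ?\<rho> = "\<lambda>x. regs s (\<Gamma> x)"
  let ?\<beta> = "\<beta>(x := bound e \<beta> \<alpha>)"
  let ?N = "den e ?\<rho> (arrs s)" and ?h = "\<lambda>i. den f (?\<rho>(x := i)) (arrs s)"
  let ?post = "\<lambda>s'. arrs s' = arrs s \<and> (\<forall>r<d. regs s' r = regs s r) \<and>
          regs s' d = den (Fold g x e f) ?\<rho> (arrs s)"
  have N: "?N \<le> bound e \<beta> \<alpha>" by (intro den_le_bound Fold.prems)
  have h: "?h i \<le> bound f ?\<beta> \<alpha>" if "i < ?N" for i
    by (intro den_le_bound) (use Fold.prems N that in auto)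
  have L: "bits e \<beta> \<alpha> \<le> L" "bits f ?\<beta> \<alpha> \<le> L" and
    L3: "size_of (agg_bound g (bound e \<beta> \<alpha>) (bound f ?\<beta> \<alpha>)) \<le> L" using Fold.prems by simp_all
  have L1: "1 \<le> L" using bits_ge_1[of e \<beta> \<alpha>] L by simp
  have NL: "size_of ?N \<le> L" using size_of_mono[OF N] bound_le_bits[of e \<beta> \<alpha>] L by linarith
  have hL: "size_of (?h i) \<le> L" if "i < ?N" for i
    using size_of_mono[OF h[OF that]] bound_le_bits[of f ?\<beta> \<alpha>] L by linarith
  \<comment> \<open>The counter descends, so at value \<open>i\<close> the accumulator holds exactly
    the terms from \<open>i\<close> upwards.\<close>
  define I where "I i s' \<longleftrightarrow> arrs s' = arrs s \<and> (\<forall>r<d. regs s' r = regs s r) \<and> regs s' d = i \<and>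
    regs s' (Suc d) = aggregate g ?h {i..<?N}" for i and s' :: state
  have accL: "size_of (aggregate g ?h {i..<?N}) \<le> L" for i
  proof -
    have "aggregate g ?h {i..<?N} \<le> agg_bound g (bound e \<beta> \<alpha>) (bound f ?\<beta> \<alpha>)"
      by (rule aggregate_le) (use h N in auto)
    from size_of_mono[OF this] show ?thesis using L3 by linarith
  qed
  let ?body = "Seq (Assign d (Minus (Reg d) (Const 1))) (Seq (compile (\<Gamma>(x := d)) (Suc (Suc d)) f)
      (Assign (Suc d) (agg_expr g (Reg (Suc d)) (Reg (Suc (Suc d))))))"
  let ?sf = "steps f ?\<beta> \<alpha>"
  have body: "exec ?body s1 ((?sf + 2) * (6 * L)) (I i)" if i: "i < ?N" and s1: "I (Suc i) s1" for i and s1 :: state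
  proof (rule exec_Seq)
    have "size_of (Suc i) \<le> L" using NL size_of_mono[of "Suc i" ?N] i by linarith
    moreover have "size_of i \<le> L" using NL size_of_mono[of "i" ?N] i by linarith
    ultimately show "exec (Assign d (Minus (Reg d) (Const 1))) s1 (6 * L)
      (\<lambda>s2. arrs s2 = arrs s \<and> (\<forall>r<d. regs s2 r = regs s r) \<and> regs s2 d = i \<and>
        regs s2 (Suc d) = aggregate g ?h {Suc i..<?N})"
      using s1 L1 unfolding I_def by (intro exec_Assign) auto
    fix s2 :: state assume s2: "arrs s2 = arrs s \<and> (\<forall>r<d. regs s2 r = regs s r) \<and> regs s2 d = i \<and>
        regs s2 (Suc d) = aggregate g ?h {Suc i..<?N}"
    have \<Gamma>: "(\<Gamma>(x := d)) y < Suc (Suc d)" for y using Fold.prems(1)[of y] by auto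
    have \<rho>: "(\<lambda>y. regs s2 ((\<Gamma>(x := d)) y)) = ?\<rho>(x := i)"
      using Fold.prems(1) s2 by auto
    have 1: "regs s2 ((\<Gamma>(x := d)) y) \<le> ?\<beta> y" for y
      using fun_cong[OF \<rho>, of y] Fold.prems(2)[of y] N i by (auto split: if_splits)
    have A: "arrs s2 a l \<le> \<alpha> a" for a l using s2 Fold.prems by auto
    show "exec (Seq (compile (\<Gamma>(x := d)) (Suc (Suc d)) f)
      (Assign (Suc d) (agg_expr g (Reg (Suc d)) (Reg (Suc (Suc d)))))) s2 ((?sf + 1) * (6 * L)) (I i)"
    proof (rule exec_Seq[OF Fold.IH(2)[OF \<Gamma> 1 A L(2)]])
      fix s3 :: state assume s3: "arrs s3 = arrs s2 \<and> (\<forall>r<Suc (Suc d). regs s3 r = regs s2 r) \<and>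
        regs s3 (Suc (Suc d)) = den f (\<lambda>a. regs s2 ((\<Gamma>(x := d)) a)) (arrs s2)"
      have 3: "regs s3 (Suc (Suc d)) = ?h i" "regs s3 (Suc d) = aggregate g ?h {Suc i..<?N}"
        using s2 s3 unfolding \<rho> by auto
      have "{i..<?N} = insert i {Suc i..<?N}" using i by auto
      then have 4: "aggregate g ?h {i..<?N} = agg_val g (aggregate g ?h {Suc i..<?N}) (?h i)"
        by (simp only:) (rule aggregate_insert, auto)
      have "ecost (agg_expr g (Reg (Suc d)) (Reg (Suc (Suc d)))) s3 \<le> 5 * L"
        by (rule agg_expr_cost) (use 3 hL[OF i] accL 4[symmetric] in simp_all)
      then show "exec (Assign (Suc d) (agg_expr g (Reg (Suc d)) (Reg (Suc (Suc d))))) s3 (6 * L) (I i)"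
        using 3 4 s2 s3 L1 unfolding I_def
        by (intro exec_Assign) (auto simp: agg_expr_val)
    qed (simp add: algebra_simps del: fun_upd_apply)
  qed (simp add: algebra_simps)
  show ?case unfolding compile.simps
  proof (rule exec_Seq[OF Fold.IH(1)[OF Fold.prems(1-3) L(1)]])
    fix s1 :: state assume s1: "arrs s1 = arrs s \<and> (\<forall>r<d. regs s1 r = regs s r) \<and> regs s1 d = ?N"
    have i: "exec (Assign (Suc d) (Const (agg_init g))) s1 (6 * L) (I ?N)"
      using s1 L1 unfolding I_def
      by (intro exec_Assign) (auto simp: aggregate_empty, cases g, auto)
    \<comment> \<open>The first 3 counts the initialisation, the last test of the guard and the
      copying of the result; the 3 per iteration counts guard, decrement and accumulation.\<close>
    show "exec (Seq (Assign (Suc d) (Const (agg_init g))) (Seq (While (Reg d) ?body)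
        (Assign d (Reg (Suc d))))) s1 ((3 + ?N * (?sf + 3)) * (6 * L)) ?post"
    proof (rule exec_Seq[OF i])
      fix s2 :: state assume s2: "I ?N s2"
      have w: "exec (While (Reg d) ?body) s2 (?N * ((?sf + 2) * (6 * L) + 6 * L) + 6 * L) (I 0)"
        by (rule exec_countdown[where I = I])
          (use s2 body NL L1 in \<open>auto simp: I_def\<close>)
      show "exec (Seq (While (Reg d) ?body) (Assign d (Reg (Suc d)))) s2
        (?N * ((?sf + 2) * (6 * L) + 6 * L) + 6 * L + 6 * L) ?post"
      proof (rule exec_Seq[OF w _ order_refl])
        fix s3 :: state assume s3: "I 0 s3"
        then show "exec (Assign d (Reg (Suc d))) s3 (6 * L) ?post"
          using accL[of 0] L1 unfolding I_def
          by (intro exec_Assign) (auto simp: atLeast0LessThan)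
      qed
    qed (simp add: algebra_simps)
  next
    have "?N * (?sf + 3) \<le> bound e \<beta> \<alpha> * (?sf + 3)" using N by (rule mult_le_mono1)
    then have "steps e \<beta> \<alpha> + (3 + ?N * (?sf + 3)) \<le> steps (Fold g x e f) \<beta> \<alpha>" by simp
    from mult_le_mono1[OF this, of "6 * L"]
    show "steps e \<beta> \<alpha> * (6 * L) + (3 + ?N * (?sf + 3)) * (6 * L)
      \<le> steps (Fold g x e f) \<beta> \<alpha> * (6 * L)" by (simp only: add_mult_distrib)
  qed
qed


lemma hsem_le:
  assumes "\<And>x. \<rho> x \<le> \<beta> x" "\<And>a l. A a l \<le> \<alpha> a" "well_bounded P \<beta> \<alpha>"
  shows "hsem P \<rho> A a l \<le> \<alpha> a"
  using assms
proof (induction P arbitrary: \<rho> \<beta> A a l)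
  case (Put b e f)
  then show ?case using den_le_bound[of \<rho> \<beta> A \<alpha> f] by (auto intro: order_trans)
next
  case (Then P Q)
  then show ?case by fastforce
next
  case (Bind x e P)
  show ?case unfolding hsem.simps
    by (rule Bind.IH[OF _ _ Bind.prems(3)[unfolded well_bounded.simps]])
      (use Bind.prems den_le_bound[of \<rho> \<beta> A \<alpha> e] in auto)
next
  case (For x e P)
  have "countdown (\<lambda>i. hsem P (\<rho>(x := i))) N A a l \<le> \<alpha> a"
    if "N \<le> bound e \<beta> \<alpha>" "\<And>a l. A a l \<le> \<alpha> a" for N A a l
    using that
  proof (induction N arbitrary: A)
    case (Suc N)
    have "hsem P (\<rho>(x := N)) A a l \<le> \<alpha> a" for a l
      by (rule For.IH[OF _ _ For.prems(3)[unfolded well_bounded.simps]]) (use For.prems Suc.prems in auto)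
    then show ?case using Suc by (simp del: fun_upd_apply)
  qed simp
  then show ?case using For.prems den_le_bound[of \<rho> \<beta> A \<alpha> e] by auto
qed

lemma exec_compile_prog:
  assumes "\<And>x. \<Gamma> x < d" "\<And>x. regs s (\<Gamma> x) \<le> \<beta> x" "\<And>a l. arrs s a l \<le> \<alpha> a"
    "prog_bits P \<beta> \<alpha> \<le> L" "well_bounded P \<beta> \<alpha>"
  shows "exec (compile_prog \<Gamma> d P) s (prog_steps P \<beta> \<alpha> * (6 * L))
    (\<lambda>s'. arrs s' = hsem P (\<lambda>x. regs s (\<Gamma> x)) (arrs s) \<and> (\<forall>r<d. regs s' r = regs s r))"
  using assms
proof (induction P arbitrary: \<Gamma> d s \<beta>)
  case (Put a e f)
  let ?\<rho> = "\<lambda>x. regs s (\<Gamma> x)"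
  let ?v = "den e ?\<rho> (arrs s)" and ?w = "den f ?\<rho> (arrs s)"
  let ?post = "\<lambda>s'. arrs s' = hsem (Put a e f) ?\<rho> (arrs s) \<and> (\<forall>r<d. regs s' r = regs s r)"
  have v: "?v \<le> bound e \<beta> \<alpha>" "?w \<le> bound f \<beta> \<alpha>" by (intro den_le_bound Put.prems)+
  have L: "bits e \<beta> \<alpha> \<le> L" "bits f \<beta> \<alpha> \<le> L" using Put.prems by simp_all
  show ?case unfolding compile_prog.simps
  proof (rule exec_Seq[OF exec_compile[OF Put.prems(1-3) L(1)]])
    fix s' :: state assume s': "arrs s' = arrs s \<and> (\<forall>r<d. regs s' r = regs s r) \<and> regs s' d = ?v"
    have \<Gamma>: "\<And>x. \<Gamma> x < Suc d" "\<And>x. regs s' (\<Gamma> x) = regs s (\<Gamma> x)"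
      using Put.prems(1) s' less_SucI by blast+
    have 1: "exec (compile \<Gamma> (Suc d) f) s' (steps f \<beta> \<alpha> * (6 * L)) (\<lambda>s''. arrs s'' = arrs s \<and>
      (\<forall>r<d. regs s'' r = regs s r) \<and> regs s'' d = ?v \<and> regs s'' (Suc d) = ?w)"
      by (rule exec_mono[OF exec_compile[where \<beta> = \<beta> and \<alpha> = \<alpha> and L = L]])
        (use \<Gamma> Put.prems s' L in \<open>simp_all add: less_Suc_eq\<close>)
    show "exec (Seq (compile \<Gamma> (Suc d) f) (Store a (Reg d) (Reg (Suc d)))) s'
      (steps f \<beta> \<alpha> * (6 * L) + 6 * L) ?post"
    proof (rule exec_Seq[OF 1 _ order_refl])
      fix s2 :: state assume s2: "arrs s2 = arrs s \<and> (\<forall>r<d. regs s2 r = regs s r) \<and> regs s2 d = ?v \<and>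
        regs s2 (Suc d) = ?w"
      have "size_of ?v \<le> L" "size_of ?w \<le> L"
        using size_of_mono[OF v(1)] bound_le_bits[of e \<beta> \<alpha>]
          size_of_mono[OF v(2)] bound_le_bits[of f \<beta> \<alpha>] L by linarith+
      moreover have "1 \<le> L" using bits_ge_1[of e \<beta> \<alpha>] L by simp
      ultimately show "exec (Store a (Reg d) (Reg (Suc d))) s2 (6 * L) ?post"
        using s2 by (intro exec_Store) auto
    qed
  qed (simp add: algebra_simps)
next
  case (Then P Q)
  have L: "prog_bits P \<beta> \<alpha> \<le> L" "prog_bits Q \<beta> \<alpha> \<le> L"
    and w: "well_bounded P \<beta> \<alpha>" "well_bounded Q \<beta> \<alpha>" using Then.prems by simp_all
  show ?case unfolding compile_prog.simps
  proof (rule exec_Seq[OF Then.IH(1)[OF Then.prems(1-3) L(1) w(1)]])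
    fix s' :: state assume s': "arrs s' = hsem P (\<lambda>x. regs s (\<Gamma> x)) (arrs s) \<and> (\<forall>r<d. regs s' r = regs s r)"
    have \<Gamma>: "\<And>x. regs s' (\<Gamma> x) = regs s (\<Gamma> x)"
      using Then.prems(1) s' by blast
    have A: "arrs s' a l \<le> \<alpha> a" for a l
      using s' hsem_le[OF _ _ w(1)] Then.prems(2,3) by simp
    show "exec (compile_prog \<Gamma> d Q) s' (prog_steps Q \<beta> \<alpha> * (6 * L))
     (\<lambda>s'. arrs s' = hsem (Then P Q) (\<lambda>x. regs s (\<Gamma> x)) (arrs s) \<and> (\<forall>r<d. regs s' r = regs s r))"
      by (rule exec_mono[OF Then.IH(2)[where \<beta> = \<beta>]]) (use \<Gamma> A s' L w Then.prems in auto)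
  qed (simp add: algebra_simps)
next
  case (Bind x e P)
  let ?\<rho> = "\<lambda>x. regs s (\<Gamma> x)"
  let ?\<beta> = "\<beta>(x := bound e \<beta> \<alpha>)"
  have L: "bits e \<beta> \<alpha> \<le> L" "prog_bits P ?\<beta> \<alpha> \<le> L"
    and w: "well_bounded P ?\<beta> \<alpha>" using Bind.prems by simp_all
  have v: "den e ?\<rho> (arrs s) \<le> bound e \<beta> \<alpha>" by (intro den_le_bound Bind.prems)
  show ?case unfolding compile_prog.simps
  proof (rule exec_Seq[OF exec_compile[OF Bind.prems(1-3) L(1)]])
    fix s' :: state assume s': "arrs s' = arrs s \<and> (\<forall>r<d. regs s' r = regs s r) \<and>
      regs s' d = den e ?\<rho> (arrs s)"
    have \<Gamma>: "(\<Gamma>(x := d)) y < Suc d" for y using Bind.prems(1)[of y] by auto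
    have \<rho>: "(\<lambda>y. regs s' ((\<Gamma>(x := d)) y)) = ?\<rho>(x := den e ?\<rho> (arrs s))"
      using Bind.prems(1) s' by auto
    have 1: "regs s' ((\<Gamma>(x := d)) y) \<le> ?\<beta> y" for y
      using fun_cong[OF \<rho>, of y] Bind.prems(2)[of y] v by (auto split: if_splits)
    have A: "arrs s' a l \<le> \<alpha> a" for a l using s' Bind.prems by auto
    show "exec (compile_prog (\<Gamma>(x := d)) (Suc d) P) s' (prog_steps P ?\<beta> \<alpha> * (6 * L))
     (\<lambda>s'. arrs s' = hsem (Bind x e P) ?\<rho> (arrs s) \<and> (\<forall>r<d. regs s' r = regs s r))"
      by (rule exec_mono[OF Bind.IH[OF \<Gamma> 1 A L(2) w]])
        (use s' in \<open>auto simp: \<rho> simp del: fun_upd_apply\<close>)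
  qed (simp add: algebra_simps del: fun_upd_apply)
next
  case (For x e P)
  let ?\<rho> = "\<lambda>x. regs s (\<Gamma> x)"
  let ?\<beta> = "\<beta>(x := bound e \<beta> \<alpha>)"
  let ?N = "den e ?\<rho> (arrs s)"
  let ?step = "\<lambda>i. hsem P (?\<rho>(x := i))"
  let ?post = "\<lambda>s'. arrs s' = hsem (For x e P) ?\<rho> (arrs s) \<and> (\<forall>r<d. regs s' r = regs s r)"
  have L: "bits e \<beta> \<alpha> \<le> L" "prog_bits P ?\<beta> \<alpha> \<le> L"
    and w: "well_bounded P ?\<beta> \<alpha>" using For.prems by simp_all
  have L1: "1 \<le> L" using bits_ge_1[of e \<beta> \<alpha>] L by simp
  have N: "?N \<le> bound e \<beta> \<alpha>" by (intro den_le_bound For.prems)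
  have NL: "size_of ?N \<le> L" using size_of_mono[OF N] bound_le_bits[of e \<beta> \<alpha>] L by linarith
  \<comment> \<open>The invariant does not describe the arrays reached so far; it says that the
    remaining \<open>i\<close> iterations turn them into the final ones.\<close>
  define I where "I i s' \<longleftrightarrow> (\<forall>a l. arrs s' a l \<le> \<alpha> a) \<and> (\<forall>r<d. regs s' r = regs s r) \<and>
    regs s' d = i \<and> countdown ?step i (arrs s') = countdown ?step ?N (arrs s)" for i and s' :: state
  let ?body = "Seq (Assign d (Minus (Reg d) (Const 1))) (compile_prog (\<Gamma>(x := d)) (Suc d) P)"
  let ?sP = "prog_steps P ?\<beta> \<alpha>"
  have body: "exec ?body s1 ((?sP + 1) * (6 * L)) (I i)"
    if i: "i < ?N" and s1: "I (Suc i) s1" for i and s1 :: state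
  proof (rule exec_Seq)
    have "size_of (Suc i) \<le> L" using NL size_of_mono[of "Suc i" ?N] i by linarith
    moreover have "size_of i \<le> L" using NL size_of_mono[of "i" ?N] i by linarith
    ultimately show "exec (Assign d (Minus (Reg d) (Const 1))) s1 (6 * L)
      (\<lambda>s2. arrs s2 = arrs s1 \<and> (\<forall>r<d. regs s2 r = regs s r) \<and> regs s2 d = i)"
      using s1 L1 unfolding I_def by (intro exec_Assign) auto
    fix s2 :: state assume s2: "arrs s2 = arrs s1 \<and> (\<forall>r<d. regs s2 r = regs s r) \<and> regs s2 d = i"
    have \<Gamma>: "(\<Gamma>(x := d)) y < Suc d" for y using For.prems(1)[of y] by auto
    have \<rho>: "(\<lambda>y. regs s2 ((\<Gamma>(x := d)) y)) = ?\<rho>(x := i)"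
      using For.prems(1) s2 by auto
    have 1: "regs s2 ((\<Gamma>(x := d)) y) \<le> ?\<beta> y" for y
      using fun_cong[OF \<rho>, of y] For.prems(2)[of y] N i by (auto split: if_splits)
    have A: "arrs s2 a l \<le> \<alpha> a" for a l using s1 s2 unfolding I_def by auto
    have A': "?step i (arrs s2) a l \<le> \<alpha> a" for a l
      by (rule hsem_le[OF _ A w]) (use 1 \<rho> fun_cong[OF \<rho>] in metis)
    show "exec (compile_prog (\<Gamma>(x := d)) (Suc d) P) s2 (?sP * (6 * L)) (I i)"
      by (rule exec_mono[OF For.IH[OF \<Gamma> 1 A L(2) w]])
        (use s1 s2 A' in \<open>auto simp: \<rho> I_def simp del: fun_upd_apply\<close>)
  qed (simp add: algebra_simps del: fun_upd_apply)
  show ?case unfolding compile_prog.simps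
  proof (rule exec_Seq[OF exec_compile[OF For.prems(1-3) L(1)]])
    fix s1 :: state assume s1: "arrs s1 = arrs s \<and> (\<forall>r<d. regs s1 r = regs s r) \<and> regs s1 d = ?N"
    have "exec (While (Reg d) ?body) s1 (?N * ((?sP + 1) * (6 * L) + 6 * L) + 6 * L) (I 0)"
    proof (rule exec_countdown)
      show "I ?N s1" using s1 For.prems unfolding I_def by simp
      show "regs s2 d = i" if "I i s2" for i and s2 :: state using that unfolding I_def by simp
    qed (use body NL L1 in simp_all)
    then show "exec (While (Reg d) ?body) s1 ((1 + ?N * (?sP + 2)) * (6 * L)) ?post"
      by (rule exec_mono) (auto simp: I_def algebra_simps simp del: fun_upd_apply)
  next
    have "?N * (?sP + 2) \<le> bound e \<beta> \<alpha> * (?sP + 2)" using N by (rule mult_le_mono1)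
    then have "steps e \<beta> \<alpha> + (1 + ?N * (?sP + 2)) \<le> prog_steps (For x e P) \<beta> \<alpha>" by simp
    from mult_le_mono1[OF this, of "6 * L"]
    show "steps e \<beta> \<alpha> * (6 * L) + (1 + ?N * (?sP + 2)) * (6 * L)
      \<le> prog_steps (For x e P) \<beta> \<alpha> * (6 * L)" by (simp only: add_mult_distrib)
  qed
qed

section \<open>Groupings of the rows\<close>

lemma set_decode_subset_iff: "set_decode S \<subseteq> {..<n} \<longleftrightarrow> S < 2 ^ n"
proof
  assume "set_decode S \<subseteq> {..<n}"
  then have "set_encode (set_decode S) \<le> (\<Sum>i<n. 2 ^ i)"
    unfolding set_encode_def by (intro sum_mono2) auto
  also have "\<dots> < 2 ^ n" using sum_power2[of n] by (simp add: atLeast0LessThan)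
  finally show "S < 2 ^ n" by simp
next
  assume S: "S < 2 ^ n"
  show "set_decode S \<subseteq> {..<n}"
  proof
    fix i assume "i \<in> set_decode S"
    then have "S div 2 ^ i \<noteq> 0" unfolding set_decode_def by (intro notI) simp
    then have "2 ^ i \<le> S" by (simp add: div_eq_0_iff)
    then have "(2::nat) ^ i < 2 ^ n" using S by linarith
    then show "i \<in> {..<n}" by simp
  qed
qed

text \<open>Disjoint sets have no binary digit in common, so adding their codes produces no carry.
  This lets the machine form unions by addition.\<close>

lemma set_decode_add:
  assumes "set_decode S \<inter> set_decode T = {}"
  shows "set_decode (S + T) = set_decode S \<union> set_decode T"
proof -
  have "S + T = set_encode (set_decode S) + set_encode (set_decode T)" by simp
  also have "\<dots> = set_encode (set_decode S \<union> set_decode T)"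
    unfolding set_encode_def using assms by (subst sum.union_disjoint) auto
  finally show ?thesis by (simp add: set_encode_inverse)
qed

lemma set_decode_all: "set_decode (2 ^ n - 1) = {..<n}"
proof -
  have "set_encode {..<n} = 2 ^ n - 1" unfolding set_encode_def using sum_power2[of n] by (simp add: atLeast0LessThan)
  then show ?thesis using set_encode_inverse[of "{..<n}"] by simp
qed

lemma set_decode_eq_all_iff: "set_decode S = {..<n} \<longleftrightarrow> S = 2 ^ n - 1"
  using set_decode_all set_decode_inverse by metis

section \<open>Costs of blocks and the table recurrence\<close>

definition conflict :: "(nat \<Rightarrow> nat \<Rightarrow> nat) \<Rightarrow> nat set \<Rightarrow> nat \<Rightarrow> bool" where
  "conflict E T j \<longleftrightarrow> (\<exists>i\<in>T. \<exists>i'\<in>T. E i j \<noteq> E i' j)"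

definition group_cost :: "(nat \<Rightarrow> nat \<Rightarrow> nat) \<Rightarrow> nat \<Rightarrow> nat set \<Rightarrow> nat" where
  "group_cost E m T = card T * card {j. j < m \<and> conflict E T j}"

text \<open>Blocks are removed one at a time so that each rule application mirrors one use of the
  recurrence, with \<open>R\<close> the complement of \<open>S\<close>. The predicate serves the
  lower bound on costs; attainment is shown through \<open>selection\<close>.\<close>

inductive grouping :: "(nat \<Rightarrow> nat \<Rightarrow> nat) \<Rightarrow> nat \<Rightarrow> nat \<Rightarrow> nat set \<Rightarrow> nat \<Rightarrow> bool" for E m k where
  empty: "grouping E m k {} 0"
| step: "T \<subseteq> R \<Longrightarrow> k \<le> card T \<Longrightarrow> grouping E m k (R - T) c \<Longrightarrow>
     grouping E m k R (c + group_cost E m T)"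

definition valid :: "nat \<Rightarrow> nat \<Rightarrow> nat \<Rightarrow> bool" where
  "valid k S T \<longleftrightarrow> set_decode S \<inter> set_decode T = {} \<and> k \<le> card (set_decode T)"

text \<open>\<open>F S\<close> is \<open>n * m + 1\<close> minus the least cost of grouping the rows outside \<open>S\<close>, or 0 if these
  rows cannot be grouped; this makes truncated subtraction propagate infeasibility.\<close>

definition extend :: "nat \<Rightarrow> (nat \<Rightarrow> nat \<Rightarrow> nat) \<Rightarrow> nat \<Rightarrow> nat \<Rightarrow> (nat \<Rightarrow> nat) \<Rightarrow> nat \<Rightarrow> nat" where
  "extend k E m n F S = Max (insert 0 ((\<lambda>T. if valid k S T
     then F (S + T) - group_cost E m (set_decode T) else 0) ` {..<2 ^ n}))"

text \<open>Entries below \<open>i\<close> are unconstrained, which makes this the invariant of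
  filling the table downwards. For the full set nothing remains to be grouped, at cost 0.\<close>

definition table :: "nat \<Rightarrow> (nat \<Rightarrow> nat \<Rightarrow> nat) \<Rightarrow> nat \<Rightarrow> nat \<Rightarrow> nat \<Rightarrow> (nat \<Rightarrow> nat) \<Rightarrow> bool" where
  "table k E m n i F \<longleftrightarrow> F (2 ^ n - 1) = n * m + 1 \<and>
     (\<forall>S. i \<le> S \<and> S < 2 ^ n - 1 \<longrightarrow> F S = extend k E m n F S)"

text \<open>An optimal next block, found by a maximum because a maximum is available as a fold. The
  default 0 means that there is no such block: for \<open>0 < k\<close> a valid \<open>T\<close> is
  never 0.\<close>

definition pick :: "nat \<Rightarrow> (nat \<Rightarrow> nat \<Rightarrow> nat) \<Rightarrow> nat \<Rightarrow> nat \<Rightarrow> (nat \<Rightarrow> nat) \<Rightarrow> nat \<Rightarrow> nat" where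
  "pick k E m n F S = Max (insert 0 ((\<lambda>T. if valid k S T \<and>
     F S = F (S + T) - group_cost E m (set_decode T) then T else 0) ` {..<2 ^ n}))"

lemma valid_pos: "valid k S T \<Longrightarrow> 0 < k \<Longrightarrow> 0 < T"
  unfolding valid_def by (cases "T = 0") auto

text \<open>A valid block has a positive code, so only cells strictly above \<open>S\<close> are
  read and a write at \<open>i \<le> S\<close> goes unnoticed. Hence finished entries stay correct
  while lower ones are written.\<close>

lemma extend_update:
  assumes "0 < k" "i \<le> S"
  shows "extend k E m n (F(i := v)) S = extend k E m n F S"
proof -
  have "(if valid k S T then (F(i := v)) (S + T) - group_cost E m (set_decode T) else 0) =
    (if valid k S T then F (S + T) - group_cost E m (set_decode T) else 0)" for T
    using valid_pos[of k S T] assms by auto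
  then show ?thesis unfolding extend_def by simp
qed

lemma table_step:
  assumes "table k E m n (Suc i) F" "0 < k" "i < 2 ^ n - 1"
  shows "table k E m n i (F(i := extend k E m n F i))"
  unfolding table_def
proof (intro conjI allI impI)
  show "(F(i := extend k E m n F i)) (2 ^ n - 1) = n * m + 1"
    using assms unfolding table_def by auto
  fix S assume "i \<le> S \<and> S < 2 ^ n - 1"
  then show "(F(i := extend k E m n F i)) S = extend k E m n (F(i := extend k E m n F i)) S"
    using assms extend_update[of k i S E m n F] unfolding table_def
    by (cases "i = S") auto
qed

text \<open>No grouping beats the table. The additive form makes truncation harmless, since
  \<open>x - g + g\<close> is at least \<open>x\<close>; in particular \<open>F S\<close> need not
  be known to be positive.\<close>

lemma table_grouping:
  assumes F: "table k E m n 0 F" and k: "0 < k"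
  shows "grouping E m k R c \<Longrightarrow> R = {..<n} - set_decode S \<Longrightarrow> S < 2 ^ n \<Longrightarrow> n * m + 1 \<le> F S + c"
proof (induction arbitrary: S rule: grouping.induct)
  case empty
  then have "set_decode S = {..<n}" using set_decode_subset_iff[of S n] by auto
  then show ?case using F set_decode_eq_all_iff unfolding table_def by auto
next
  case (step T R c)
  define T' where "T' = set_encode T"
  have "finite T" using step.hyps step.prems finite_subset[of T "{..<n}"] by auto
  then have T': "set_decode T' = T" unfolding T'_def by (rule set_encode_inverse)
  have v: "valid k S T'" unfolding valid_def T' using step by auto
  have d: "set_decode (S + T') = set_decode S \<union> T"
    using set_decode_add[of S T'] T' step by auto
  have lt: "S + T' < 2 ^ n" "T' < 2 ^ n"
    using step d T' set_decode_subset_iff[of S n]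
    unfolding set_decode_subset_iff[symmetric] by auto
  have IH: "n * m + 1 \<le> F (S + T') + c"
    by (rule step.IH) (use d lt step.prems in auto)
  have "T \<noteq> {}" using step.hyps k by auto
  then have "set_decode S \<noteq> {..<n}" using step by auto
  then have "S < 2 ^ n - 1" using step.prems set_decode_all by (cases "S = 2 ^ n - 1") auto
  then have "F S = extend k E m n F S" using F unfolding table_def by auto
  moreover have "F (S + T') - group_cost E m T \<le> extend k E m n F S"
    unfolding extend_def using lt v T' by (intro Max_ge) (auto intro!: image_eqI[of _ _ T'])
  ultimately show ?case using IH by simp
qed

section \<open>Reading an optimal grouping off the table\<close>

text \<open>Makes the surplus rounds of the reconstruction harmless: once all rows are covered, the
  slot receives 0, which it already holds.\<close>

lemma pick_full: "0 < k \<Longrightarrow> pick k E m n F (2 ^ n - 1) = 0"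
proof -
  assume k: "0 < k"
  have "\<not> valid k (2 ^ n - 1) T" if "T < 2 ^ n" for T
    using that k set_decode_subset_iff[of T n] unfolding valid_def set_decode_all
    by (metis card.empty inf.absorb_iff2 not_le)
  then have "pick k E m n F (2 ^ n - 1) = Max (insert 0 ((\<lambda>T. 0) ` {..<2 ^ n :: nat}))"
    unfolding pick_def by (intro arg_cong[where f = "\<lambda>A. Max (insert 0 A)"] image_cong) auto
  also have "insert 0 ((\<lambda>T. 0) ` {..<2 ^ n :: nat}) = {0 :: nat}" by auto
  finally show ?thesis by simp
qed

text \<open>Positivity of \<open>F S\<close> excludes the inserted 0 as the maximum and shows that
  the subtraction is not truncated, so the accounting becomes an exact equation.\<close>

lemma pick_valid:
  assumes F: "table k E m n 0 F" and k: "0 < k" and S: "S < 2 ^ n - 1" and pos: "0 < F S"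
  defines "T \<equiv> pick k E m n F S"
  shows "valid k S T" "T < 2 ^ n" "F S + group_cost E m (set_decode T) = F (S + T)"
proof -
  let ?h = "\<lambda>T. if valid k S T then F (S + T) - group_cost E m (set_decode T) else 0"
  have "F S = Max (insert 0 (?h ` {..<2 ^ n}))"
    using F S unfolding table_def extend_def by simp
  moreover have "Max (insert 0 (?h ` {..<2 ^ n})) \<in> insert 0 (?h ` {..<2 ^ n})" by (rule Max_in) auto
  ultimately obtain U where U: "U < 2 ^ n" "F S = ?h U" using pos by auto
  then have vU: "valid k S U" using pos by (metis less_irrefl)
  let ?g = "\<lambda>T. if valid k S T \<and> F S = F (S + T) - group_cost E m (set_decode T) then T else 0"
  \<comment> \<open>\<open>U\<close> attains the maximum in the recurrence, so it is a candidate for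
    \<open>pick\<close>; therefore \<open>T\<close> is a genuine candidate and not the default
    0.\<close>
  have "U \<le> T" unfolding T_def pick_def using U vU
    by (intro Max_ge) (auto intro!: image_eqI[of _ _ U])
  then have T0: "0 < T" using valid_pos[OF vU k] by simp
  have "T \<in> insert 0 (?g ` {..<2 ^ n})" unfolding T_def pick_def by (rule Max_in) auto
  then obtain V where "V < 2 ^ n" "T = ?g V" using T0 by auto
  then have "T = V" "valid k S T" "F S = F (S + T) - group_cost E m (set_decode T)" "T < 2 ^ n"
    using T0 by (auto split: if_splits)
  then show "valid k S T" "T < 2 ^ n" "F S + group_cost E m (set_decode T) = F (S + T)"
    using pos by auto
qed

text \<open>Invariant of the reconstruction when slots from \<open>i\<close> upwards have been
  visited. A slot holding 0 decodes to the empty block. The sum of the slots is the code of the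
  covered rows, and the last conjunct records progress: as long as rows are missing, each round has
  covered at least one.\<close>

definition selection :: "nat \<Rightarrow> (nat \<Rightarrow> nat \<Rightarrow> nat) \<Rightarrow> nat \<Rightarrow> nat \<Rightarrow> (nat \<Rightarrow> nat) \<Rightarrow> nat \<Rightarrow> (nat \<Rightarrow> nat) \<Rightarrow> bool"
  where "selection k E m n F i G \<longleftrightarrow> (\<forall>t<i. G t = 0) \<and> (\<forall>t<n. G t = 0 \<or> k \<le> card (set_decode (G t))) \<and>
    disjoint_family_on (\<lambda>t. set_decode (G t)) {..<n} \<and>
    set_decode (\<Sum>t<n. G t) = (\<Union>t<n. set_decode (G t)) \<and> (\<Sum>t<n. G t) < 2 ^ n \<and>
    F 0 + (\<Sum>t<n. group_cost E m (set_decode (G t))) = F (\<Sum>t<n. G t) \<and>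
    ((\<Sum>t<n. G t) = 2 ^ n - 1 \<or> n - i \<le> card (set_decode (\<Sum>t<n. G t)))"

lemma group_cost_empty [simp]: "group_cost E m {} = 0"
  by (simp add: group_cost_def)

lemma selection_init: "selection k E m n F n (\<lambda>t. 0)"
  unfolding selection_def by (auto simp: disjoint_family_on_def)

lemma selection_step:
  assumes F: "table k E m n 0 F" "0 < k" "0 < F 0"
    and G: "selection k E m n F (Suc i) G" and i: "i < n"
  shows "selection k E m n F i (G(i := pick k E m n F (\<Sum>t<n. G t)))"
proof -
  define S where "S = (\<Sum>t<n. G t)"
  define T where "T = pick k E m n F S"
  note G = G[unfolded selection_def, folded S_def]
  show ?thesis
  proof (cases "S = 2 ^ n - 1")
    case True
    then have "G(i := T) = G" unfolding T_def using G pick_full[OF F(2)] by (auto simp: fun_eq_iff)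
    then show ?thesis using G True
      unfolding S_def[symmetric] T_def[symmetric] selection_def by (simp add: S_def[symmetric])
  next
    case False
    then have S: "S < 2 ^ n - 1" using G by auto
    \<comment> \<open>The accounting equation bounds \<open>F S\<close> below by \<open>F 0\<close>,
      so feasibility is inherited along the reconstruction.\<close>
    have "0 < F S" using G F(3) by (metis add_gr_0)
    note T = pick_valid[OF F(1,2) S this, folded T_def]
    have dis: "set_decode S \<inter> set_decode T = {}" and kT: "k \<le> card (set_decode T)"
      using T(1) unfolding valid_def by auto
    have G0: "G i = 0" using G by auto
    \<comment> \<open>Slot \<open>i\<close> was 0, so filling it adds just the contribution of
      \<open>T\<close>. This is used with \<open>h\<close> the identity and with \<open>h\<close>
      the cost of the decoded block.\<close>
    have sum: "(\<Sum>t<n. h ((G(i := T)) t)) = (\<Sum>t<n. h (G t)) + h T" if "h 0 = 0" for h :: "nat \<Rightarrow> nat"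
    proof -
      have "(\<Sum>t<n. h ((G(i := T)) t)) = h T + (\<Sum>t\<in>{..<n} - {i}. h ((G(i := T)) t))"
        using i by (subst sum.remove[of _ i]) auto
      also have "(\<Sum>t\<in>{..<n} - {i}. h ((G(i := T)) t)) = (\<Sum>t\<in>{..<n} - {i}. h (G t))"
        by (rule sum.cong) auto
      also have "\<dots> = (\<Sum>t<n. h (G t))"
        using i G0 that by (subst (2) sum.remove[of _ i]) auto
      finally show ?thesis by simp
    qed
    have sumS: "(\<Sum>t<n. (G(i := T)) t) = S + T" using sum[of id] unfolding S_def by simp
    have dec: "set_decode (S + T) = set_decode S \<union> set_decode T" by (rule set_decode_add[OF dis])
    have un: "(\<Union>t<n. set_decode ((G(i := T)) t)) = (\<Union>t<n. set_decode (G t)) \<union> set_decode T"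
      (is "?A = ?B")
    proof
      show "?A \<subseteq> ?B" by (auto split: if_splits)
      have "set_decode (G t) \<subseteq> set_decode ((G(i := T)) t)" for t using G0 by auto
      then show "?B \<subseteq> ?A" using i by fastforce
    qed
    have dS: "set_decode S = (\<Union>t<n. set_decode (G t))" using G by auto
    have "S + T < 2 ^ n"
      using dec G T(2) unfolding set_decode_subset_iff[symmetric] by auto
    moreover have "disjoint_family_on (\<lambda>t. set_decode ((G(i := T)) t)) {..<n}"
      using G dis unfolding dS disjoint_family_on_def by auto
    moreover have "card (set_decode (S + T)) = card (set_decode S) + card (set_decode T)"
      unfolding dec using dis by (simp add: card_Un_disjoint)
    moreover have "F 0 + (\<Sum>t<n. group_cost E m (set_decode ((G(i := T)) t))) = F (S + T)"
      using G T(3) sum[of "\<lambda>x. group_cost E m (set_decode x)"] by simp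
    ultimately show ?thesis
      unfolding S_def[symmetric] T_def[symmetric] selection_def sumS un dec
      using G kT F(2) False dS i by auto
  qed
qed

text \<open>At \<open>i = 0\<close> the progress clause offers either the full code or at least
  \<open>n\<close> covered rows, and both leave no row uncovered.\<close>

lemma selection_full:
  assumes "selection k E m n F 0 G"
  shows "(\<Union>t<n. set_decode (G t)) = {..<n}" "(\<Sum>t<n. G t) = 2 ^ n - 1"
proof -
  let ?S = "\<Sum>t<n. G t"
  have sub: "set_decode ?S \<subseteq> {..<n}"
    using assms unfolding selection_def set_decode_subset_iff by auto
  have "set_decode ?S = {..<n}"
  proof (cases "?S = 2 ^ n - 1")
    case True
    then show ?thesis using set_decode_all[of n] by simp
  next
    case False
    then have "n \<le> card (set_decode ?S)" using assms unfolding selection_def by auto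
    then show ?thesis using sub card_subset_eq[OF _ sub] card_mono[OF _ sub] by auto
  qed
  then show "(\<Union>t<n. set_decode (G t)) = {..<n}" "?S = 2 ^ n - 1"
    using assms set_decode_eq_all_iff unfolding selection_def by auto
qed

section \<open>Anonymizations versus groupings\<close>

text \<open>Induction on the size of \<open>R\<close>, removing the class of rows of
  \<open>B\<close> equal to a chosen row. Closure of \<open>R\<close> keeps the class inside
  \<open>R\<close> and passes to the remainder; anonymity gives the class at least \<open>k\<close>
  rows.\<close>

lemma grouping_if_closed:
  fixes B :: "'b option mat"
  assumes B: "B \<in> carrier_mat n m" "k_anonymous k B" and k: "0 < k"
    and E: "\<And>i i' j. i < n \<Longrightarrow> i' < n \<Longrightarrow> j < m \<Longrightarrow> B $$ (i, j) = B $$ (i', j) \<Longrightarrow>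
      B $$ (i, j) \<noteq> None \<Longrightarrow> E i j = E i' j"
  shows "R \<subseteq> {..<n} \<Longrightarrow> \<forall>i\<in>R. \<forall>j<n. row B j = row B i \<longrightarrow> j \<in> R \<Longrightarrow>
    \<exists>c \<le> card {(i, j). i \<in> R \<and> j < m \<and> B $$ (i, j) = None}. grouping E m k R c"
proof (induction "card R" arbitrary: R rule: less_induct)
  case less
  let ?stars = "\<lambda>R. {(i, j). i \<in> R \<and> j < m \<and> B $$ (i, j) = None}"
  have fin: "finite (?stars R)" if "R \<subseteq> {..<n}" for R
    by (rule finite_subset[of _ "{..<n} \<times> {..<m}"]) (use that in auto)
  show ?case
  proof (cases "R = {}")
    case True
    then show ?thesis using grouping.empty by blast
  next
    case False
    then obtain i where i: "i \<in> R" by auto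
    define T where "T = {j. j < n \<and> row B j = row B i}"
    have iT: "i \<in> T" and TR: "T \<subseteq> R" and Tn: "T \<subseteq> {..<n}" using i less.prems unfolding T_def by auto
    have dims: "dim_row B = n" "dim_col B = m" using B by auto
    have fT: "finite T" using Tn finite_subset by blast
    have "{j. j < dim_row B \<and> j \<noteq> i \<and> row B j = row B i} = T - {i}"
      unfolding T_def dims by auto
    then have "k - 1 \<le> card (T - {i})" using B(2) i less.prems(1) dims unfolding k_anonymous_def by force
    then have kT: "k \<le> card T" using iT fT k card_gt_0_iff[of T] by auto
    have "finite R" using less.prems(1) finite_subset by blast
    then have "card (R - T) < card R" using iT i by (intro psubset_card_mono) auto
    moreover have "R - T \<subseteq> {..<n}" using less.prems(1) by auto
    moreover have "\<forall>a\<in>R - T. \<forall>j<n. row B j = row B a \<longrightarrow> j \<in> R - T"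
    proof (intro ballI allI impI)
      fix a j assume a: "a \<in> R - T" "j < n" "row B j = row B a"
      then have "a < n" "j \<in> R" using less.prems by blast+
      then show "j \<in> R - T" using a unfolding T_def by simp
    qed
    ultimately obtain c where c: "c \<le> card (?stars (R - T))" "grouping E m k (R - T) c"
      using less.hyps[of "R - T"] by blast
    \<comment> \<open>All rows of the class share one entry of \<open>B\<close> in column
      \<open>j\<close>. If that entry were a letter, the original entries would agree, so a conflict
      forces a star in every row of the class.\<close>
    have "T \<times> {j. j < m \<and> conflict E T j} \<subseteq> ?stars T"
    proof
      fix p assume "p \<in> T \<times> {j. j < m \<and> conflict E T j}"
      then obtain a j where p: "p = (a, j)" and a: "a \<in> T" and j: "j < m" "conflict E T j" by blast
      obtain b b' where b: "b \<in> T" "b' \<in> T" "E b j \<noteq> E b' j" using j unfolding conflict_def by auto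
      have eq: "B $$ (x, j) = B $$ (i, j)" if "x \<in> T" for x
        using that i less.prems(1) j(1) dims index_row(1)[of x B j] index_row(1)[of i B j]
        unfolding T_def by auto
      have "b < n" "b' < n" using b Tn by auto
      then have "B $$ (i, j) = None" using E[of b b' j] b(3) eq[OF b(1)] eq[OF b(2)] j(1) by metis
      then show "p \<in> ?stars T" using a j eq p by simp
    qed
    from card_mono[OF fin[OF Tn] this] have "group_cost E m T \<le> card (?stars T)"
      unfolding group_cost_def by (simp add: card_cartesian_product)
    moreover have "card (?stars R) = card (?stars (R - T)) + card (?stars T)"
    proof -
      have "?stars R = ?stars (R - T) \<union> ?stars T" using TR by auto
      then show ?thesis using fin[OF Tn] fin[of "R - T"] less.prems(1)
        by (simp only:) (rule card_Un_disjoint, auto)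
    qed
    ultimately have "c + group_cost E m T \<le> card (?stars R)" using c by linarith
    moreover have "grouping E m k R (c + group_cost E m T)"
      using grouping.step[OF TR kT c(2)] .
    ultimately show ?thesis by blast
  qed
qed

lemma anonymization_grouping:
  assumes B: "k_anonymization k D B" and D: "D \<in> carrier_mat n m" and k: "0 < k"
    and E: "\<And>i j. i < n \<Longrightarrow> j < m \<Longrightarrow> E i j = code (Some (D $$ (i, j)))"
  shows "\<exists>c \<le> anon_cost B. grouping E m k {..<n} c"
proof -
  have s: "B \<in> carrier_mat n m"
    "\<And>i j. i < n \<Longrightarrow> j < m \<Longrightarrow> B $$ (i, j) = Some (D $$ (i, j)) \<or> B $$ (i, j) = None"
    using B D unfolding k_anonymization_def suppression_def by auto
  have "E i j = E i' j" if "i < n" "i' < n" "j < m" "B $$ (i, j) = B $$ (i', j)" "B $$ (i, j) \<noteq> None" for i i' j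
    using s(2)[of i j] s(2)[of i' j] that E by auto
  then have "\<exists>c \<le> card {(i, j). i \<in> {..<n} \<and> j < m \<and> B $$ (i, j) = None}. grouping E m k {..<n} c"
    using B s(1) k by (intro grouping_if_closed) (auto simp: k_anonymization_def)
  then show ?thesis using s(1) unfolding anon_cost_def by auto
qed

lemma anon_cost_le: "B \<in> carrier_mat n m \<Longrightarrow> anon_cost B \<le> n * m"
proof -
  assume B: "B \<in> carrier_mat n m"
  have "anon_cost B \<le> card ({..<n} \<times> {..<m})"
    unfolding anon_cost_def using B by (intro card_mono) auto
  then show ?thesis by simp
qed

lemma anonymization_of_partition:
  assumes D: "D \<in> carrier_mat n m"
    and P: "disjoint_family_on P {..<n}" "(\<Union>t<n. P t) = {..<n}" "\<And>t. t < n \<Longrightarrow> P t = {} \<or> k \<le> card (P t)"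
    and E: "\<And>i j. i < n \<Longrightarrow> j < m \<Longrightarrow> E i j = code (Some (D $$ (i, j)))"
  defines "B \<equiv> mat n m (\<lambda>(i, j). if \<exists>t<n. i \<in> P t \<and> conflict E (P t) j then None
    else Some (D $$ (i, j)))"
  shows "k_anonymization k D B" "anon_cost B = (\<Sum>t<n. group_cost E m (P t))"
proof -
  have uniq: "t = t'" if "i \<in> P t" "i \<in> P t'" "t < n" "t' < n" for i t t'
    using P(1) that unfolding disjoint_family_on_def by blast
  have fin: "finite (P t)" "P t \<subseteq> {..<n}" if "t < n" for t
    using P(2) that finite_subset[of "P t" "{..<n}"] by auto
  have nth: "B $$ (i, j) = (if conflict E (P t) j then None else Some (D $$ (i, j)))"
    if "t < n" "i \<in> P t" "j < m" for i j t
  proof -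
    have "(\<exists>t'<n. i \<in> P t' \<and> conflict E (P t') j) \<longleftrightarrow> conflict E (P t) j"
      using that(1,2) uniq[OF that(2) _ that(1)] by blast
    moreover have "i < n" using fin(2)[OF that(1)] that(2) by auto
    ultimately show ?thesis unfolding B_def using that(3) by simp
  qed
  have "k - 1 \<le> card {j. j < dim_row B \<and> j \<noteq> i \<and> row B j = row B i}" if i: "i < dim_row B" for i
  proof -
    have "i < n" using i by (simp add: B_def)
    then obtain t where t: "t < n" "i \<in> P t" using P(2) by blast
    have "row B i' = row B i" if "i' \<in> P t" for i'
    proof (rule eq_vecI)
      fix j assume "j < dim_vec (row B i)"
      then have j: "j < m" by (simp add: B_def)
      have ii: "i' < n" "i < n" using fin(2)[OF t(1)] that t by auto
      have "B $$ (i', j) = B $$ (i, j)"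
      proof (cases "conflict E (P t) j")
        case False
        then have "E i' j = E i j" using that t(2) unfolding conflict_def by blast
        then have "D $$ (i', j) = D $$ (i, j)" using E[OF ii(1) j] E[OF ii(2) j] by simp
        then show ?thesis using nth[OF t j] nth[OF t(1) that j] by simp
      qed (simp add: nth[OF t j] nth[OF t(1) that j])
      then show "row B i' $ j = row B i $ j" using ii j by (simp add: B_def)
    qed (simp add: B_def)
    then have "P t - {i} \<subseteq> {j. j < dim_row B \<and> j \<noteq> i \<and> row B j = row B i}"
      using fin(2)[OF t(1)] by (auto simp: B_def)
    then have "card (P t - {i}) \<le> card {j. j < dim_row B \<and> j \<noteq> i \<and> row B j = row B i}"
      by (intro card_mono) auto
    moreover have "k \<le> card (P t)" using P(3)[OF t(1)] t(2) by blast
    ultimately show ?thesis using t(2) fin(1)[OF t(1)] by simp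
  qed
  then show "k_anonymization k D B"
    unfolding k_anonymization_def suppression_def k_anonymous_def using D by (simp add: B_def)
  have dims: "dim_row B = n" "dim_col B = m" by (simp_all add: B_def)
  have "{(i, j). i < dim_row B \<and> j < dim_col B \<and> B $$ (i, j) = None} =
    (\<Union>t<n. P t \<times> {j. j < m \<and> conflict E (P t) j})"
  proof (intro equalityI subsetI)
    fix p assume "p \<in> {(i, j). i < dim_row B \<and> j < dim_col B \<and> B $$ (i, j) = None}"
    then show "p \<in> (\<Union>t<n. P t \<times> {j. j < m \<and> conflict E (P t) j})"
      by (cases p) (auto simp: B_def split: if_splits)
  next
    fix p assume "p \<in> (\<Union>t<n. P t \<times> {j. j < m \<and> conflict E (P t) j})"
    then obtain t i j where p: "p = (i, j)" "t < n" "i \<in> P t" "j < m" "conflict E (P t) j" by blast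
    then have "i < n" using fin(2) by blast
    then show "p \<in> {(i, j). i < dim_row B \<and> j < dim_col B \<and> B $$ (i, j) = None}"
      unfolding dims using nth[OF p(2-4)] p by simp
  qed
  then have "anon_cost B = card (\<Union>t<n. P t \<times> {j. j < m \<and> conflict E (P t) j})"
    unfolding anon_cost_def by simp
  also have "\<dots> = (\<Sum>t<n. card (P t \<times> {j. j < m \<and> conflict E (P t) j}))"
    using fin(1) uniq by (intro card_UN_disjoint) (simp, simp, blast)
  finally show "anon_cost B = (\<Sum>t<n. group_cost E m (P t))"
    by (simp add: group_cost_def card_cartesian_product)
qed

text \<open>The selected blocks give \<open>F 0\<close> plus cost equal to \<open>n * m + 1\<close>,
  while every anonymization gives at least that much; cancelling \<open>F 0\<close> compares the
  costs.\<close>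

lemma optimal_of_selection:
  assumes D: "D \<in> carrier_mat n m" and k: "0 < k"
    and E: "\<And>i j. i < n \<Longrightarrow> j < m \<Longrightarrow> E i j = code (Some (D $$ (i, j)))"
    and F: "table k E m n 0 F" and G: "selection k E m n F 0 G"
  shows "optimal_k_anonymization k D (mat n m (\<lambda>(i, j).
    if \<exists>t<n. i \<in> set_decode (G t) \<and> conflict E (set_decode (G t)) j then None
    else Some (D $$ (i, j))))" (is "optimal_k_anonymization k D ?B")
proof -
  note full = selection_full[OF G]
  have d: "disjoint_family_on (\<lambda>t. set_decode (G t)) {..<n}"
    and c: "\<And>t. t < n \<Longrightarrow> set_decode (G t) = {} \<or> k \<le> card (set_decode (G t))"
    using G unfolding selection_def by auto
  note B = anonymization_of_partition[OF D d full(1) c E]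
  have "F 0 + anon_cost ?B = n * m + 1"
    using G F full(2) B(2) unfolding selection_def table_def by simp
  moreover have "n * m + 1 \<le> F 0 + anon_cost B'" if B': "k_anonymization k D B'" for B'
  proof -
    obtain c where "c \<le> anon_cost B'" "grouping E m k {..<n} c"
      using anonymization_grouping[OF B' D k E] by blast
    then show ?thesis using table_grouping[OF F k, of "{..<n}" c 0] by auto
  qed
  ultimately have "anon_cost ?B \<le> anon_cost B'" if "k_anonymization k D B'" for B'
    using that by fastforce
  then show ?thesis
    unfolding optimal_k_anonymization_def is_arg_min_linorder using B(1) by blast
qed

text \<open>Here the extra 1 in \<open>n * m + 1\<close> matters: even a fully suppressed database
  leaves \<open>F 0\<close> positive.\<close>

lemma table_pos:
  assumes D: "D \<in> carrier_mat n m" and k: "0 < k"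
    and E: "\<And>i j. i < n \<Longrightarrow> j < m \<Longrightarrow> E i j = code (Some (D $$ (i, j)))"
    and F: "table k E m n 0 F" and B: "k_anonymization k D B"
  shows "0 < F 0"
proof -
  obtain c where "c \<le> anon_cost B" "grouping E m k {..<n} c"
    using anonymization_grouping[OF B D k E] by blast
  moreover have "anon_cost B \<le> n * m"
    using B D unfolding k_anonymization_def suppression_def by (intro anon_cost_le) auto
  ultimately show ?thesis using table_grouping[OF F k, of "{..<n}" c 0] by auto
qed

section \<open>The dynamic program\<close>

text \<open>Variables: 0 and 1 for the dimensions \<open>n\<close> and \<open>m\<close>, 2 and 3 for sets \<open>S\<close> and \<open>T\<close> of rows in
  binary, 4, 5 and 10 for rows, 6 for columns, 7 and 8 for positions in the list of groups, 9 unused.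
  Arrays: 0 and 1 for input and output, 2 for the table \<open>F\<close>, 3 for the list of groups.\<close>

definition pow_exp :: "hexp \<Rightarrow> hexp" where
  "pow_exp e = Fold Prod 9 e (Num 2)"

text \<open>For want of a remainder operation, the last digit of \<open>d\<close> is obtained as
  \<open>d - 2 * (d div 2)\<close>.\<close>

definition bit_exp :: "hexp \<Rightarrow> hexp \<Rightarrow> hexp" where
  "bit_exp e f = (let d = Bin Div e (pow_exp f) in Bin Sub d (Bin Mul (Num 2) (Bin Div d (Num 2))))"

definition size_exp :: hexp where
  "size_exp = Fold Sum 4 (Var 0) (bit_exp (Var 3) (Var 4))"

text \<open>Truth values are numbers: \<open>1 - e\<close> tests for zero, and products act as
  conjunctions and as conditionals with default 0.\<close>

definition not_exp :: "hexp \<Rightarrow> hexp" where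
  "not_exp e = Bin Sub (Num 1) e"

definition differ_exp :: "hexp \<Rightarrow> hexp \<Rightarrow> hexp" where
  "differ_exp e f = Bin Add (Bin Sub e f) (Bin Sub f e)"

definition pos_exp :: "nat \<Rightarrow> hexp" where
  "pos_exp i = Bin Add (Bin Mul (Var i) (Var 1)) (Var 6)"

text \<open>A sum of naturals vanishes iff all its terms do, so the double sum acts as a universal
  quantifier over pairs of rows in the group.\<close>

definition uniform_exp :: "hexp \<Rightarrow> hexp" where
  "uniform_exp e = not_exp (Fold Sum 4 (Var 0) (Fold Sum 5 (Var 0)
     (Bin Mul (Bin Mul (bit_exp e (Var 4)) (bit_exp e (Var 5)))
        (differ_exp (Cell 0 (pos_exp 4)) (Cell 0 (pos_exp 5))))))"

definition cost_exp :: hexp where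
  "cost_exp = Bin Mul size_exp (Fold Sum 6 (Var 1) (not_exp (uniform_exp (Var 3))))"

definition valid_exp :: "nat \<Rightarrow> hexp" where
  "valid_exp k = Bin Mul
     (not_exp (Fold Sum 4 (Var 0) (Bin Mul (bit_exp (Var 2) (Var 4)) (bit_exp (Var 3) (Var 4)))))
     (not_exp (Bin Sub (Num k) size_exp))"

definition rest_exp :: hexp where
  "rest_exp = Bin Sub (Cell 2 (Bin Add (Var 2) (Var 3))) cost_exp"

text \<open>For an invalid \<open>T\<close> the cell \<open>S + T\<close> may lie outside the table;
  it is still read, but its content is multiplied by 0.\<close>

definition extend_exp :: "nat \<Rightarrow> hexp" where
  "extend_exp k = Fold Maximum 3 (pow_exp (Var 0)) (Bin Mul (valid_exp k) rest_exp)"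

definition pick_exp :: "nat \<Rightarrow> hexp" where
  "pick_exp k = Fold Maximum 3 (pow_exp (Var 0)) (Bin Mul (Bin Mul (Var 3) (valid_exp k))
     (not_exp (differ_exp (Cell 2 (Var 2)) rest_exp)))"

definition fill :: "nat \<Rightarrow> hprog" where
  "fill k = (let full = Bin Sub (pow_exp (Var 0)) (Num 1) in
     Then (Put 2 full (Bin Add (Bin Mul (Var 0) (Var 1)) (Num 1)))
       (For 2 full (Put 2 (Var 2) (extend_exp k))))"

text \<open>The covered set is recomputed in each round as the sum of all slots, so that only the
  arrays carry state between rounds.\<close>

definition select :: "nat \<Rightarrow> hprog" where
  "select k = For 7 (Var 0) (Bind 2 (Fold Sum 8 (Var 0) (Cell 3 (Var 8))) (Put 3 (Var 7) (pick_exp k)))"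

text \<open>When the slots partition the rows, at most one term of the sum is nonzero: the input
  code of an entry that is kept. For a suppressed entry all terms vanish, and 0 is the code of the
  star.\<close>

definition emit :: hprog where
  "emit = For 10 (Var 0) (For 6 (Var 1) (Put 1 (pos_exp 10)
     (Fold Sum 7 (Var 0) (Bin Mul
        (Bin Mul (bit_exp (Cell 3 (Var 7)) (Var 10)) (uniform_exp (Cell 3 (Var 7))))
        (Cell 0 (pos_exp 10))))))"

definition solve :: "nat \<Rightarrow> hprog" where
  "solve k = Then (fill k) (Then (select k) emit)"

section \<open>Meaning of the expressions\<close>

lemma den_pow [simp]: "den (pow_exp e) \<rho> A = 2 ^ den e \<rho> A"
  by (simp add: pow_exp_def)

lemma den_bit [simp]:
  "den (bit_exp e f) \<rho> A = of_bool (den f \<rho> A \<in> set_decode (den e \<rho> A))"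
proof -
  have "x - 2 * (x div 2) = of_bool (odd x)" for x :: nat
    by (simp add: minus_mult_div_eq_mod odd_iff_mod_2_eq_one)
  then show ?thesis by (simp add: bit_exp_def set_decode_def Let_def)
qed

lemma den_not [simp]: "den (not_exp e) \<rho> A = of_bool (den e \<rho> A = 0)"
  by (simp add: not_exp_def)

lemma den_differ_eq_0 [simp]: "den (differ_exp e f) \<rho> A = 0 \<longleftrightarrow> den e \<rho> A = den f \<rho> A"
  by (auto simp: differ_exp_def)

lemma den_pos [simp]: "den (pos_exp i) \<rho> A = \<rho> i * \<rho> 1 + \<rho> 6"
  by (simp add: pos_exp_def)

lemma sum_of_bool_set_decode: "T < 2 ^ n \<Longrightarrow> (\<Sum>i<n. of_bool (i \<in> set_decode T)) = card (set_decode T)"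
proof -
  assume "T < 2 ^ n"
  then have "{..<n} \<inter> {i. i \<in> set_decode T} = set_decode T" using set_decode_subset_iff by blast
  then show ?thesis by simp
qed

lemma den_size: "\<rho> 3 < 2 ^ \<rho> 0 \<Longrightarrow> den size_exp \<rho> A = card (set_decode (\<rho> 3))"
  using sum_of_bool_set_decode by (simp add: size_exp_def)

text \<open>The two sums rebind the variables 4 and 5, so the group expression \<open>e\<close> must
  keep its value under these updates.\<close>

lemma den_uniform:
  assumes e: "\<And>i i'. den e (\<rho>(4 := i)) A = T" "\<And>i i'. den e (\<rho>(4 := i, 5 := i')) A = T"
    and T: "T < 2 ^ \<rho> 0"
  shows "den (uniform_exp e) \<rho> A =
    of_bool (\<not> conflict (\<lambda>i j. A 0 (i * \<rho> 1 + j)) (set_decode T) (\<rho> 6))"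
proof -
  have "den (uniform_exp e) \<rho> A = of_bool (\<forall>i\<in>{..<\<rho> 0}. \<forall>i'\<in>{..<\<rho> 0}. i \<in> set_decode T \<longrightarrow>
      i' \<in> set_decode T \<longrightarrow> A 0 (i * \<rho> 1 + \<rho> 6) = A 0 (i' * \<rho> 1 + \<rho> 6))"
    using e(2) by (auto simp: uniform_exp_def)
  moreover have "set_decode T \<subseteq> {..<\<rho> 0}" using T set_decode_subset_iff by blast
  then have "(\<forall>i\<in>{..<\<rho> 0}. \<forall>i'\<in>{..<\<rho> 0}. i \<in> set_decode T \<longrightarrow> i' \<in> set_decode T \<longrightarrow>
      A 0 (i * \<rho> 1 + \<rho> 6) = A 0 (i' * \<rho> 1 + \<rho> 6)) \<longleftrightarrow>
    \<not> conflict (\<lambda>i j. A 0 (i * \<rho> 1 + j)) (set_decode T) (\<rho> 6)"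
    unfolding conflict_def by blast
  ultimately show ?thesis by simp
qed

lemma den_cost:
  assumes "\<rho> 3 < 2 ^ \<rho> 0"
  shows "den cost_exp \<rho> A = group_cost (\<lambda>i j. A 0 (i * \<rho> 1 + j)) (\<rho> 1) (set_decode (\<rho> 3))"
proof -
  let ?E = "\<lambda>i j. A 0 (i * \<rho> 1 + j)"
  have "den (uniform_exp (Var 3)) (\<rho>(6 := j)) A = of_bool (\<not> conflict ?E (set_decode (\<rho> 3)) j)" for j
    using assms by (subst den_uniform[where T = "\<rho> 3"]) auto
  then have "den cost_exp \<rho> A = card (set_decode (\<rho> 3)) *
    (\<Sum>j<\<rho> 1. of_bool (conflict ?E (set_decode (\<rho> 3)) j))"
    using assms by (simp add: cost_exp_def den_size)
  also have "(\<Sum>j<\<rho> 1. of_bool (conflict ?E (set_decode (\<rho> 3)) j)) =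
    card {j. j < \<rho> 1 \<and> conflict ?E (set_decode (\<rho> 3)) j}"
    by (simp add: lessThan_def Collect_conj_eq)
  finally show ?thesis by (simp add: group_cost_def)
qed

lemma den_valid:
  assumes "\<rho> 3 < 2 ^ \<rho> 0"
  shows "den (valid_exp k) \<rho> A = of_bool (valid k (\<rho> 2) (\<rho> 3))"
proof -
  have "set_decode (\<rho> 3) \<subseteq> {..<\<rho> 0}" using assms set_decode_subset_iff by blast
  then have "den (not_exp (Fold Sum 4 (Var 0) (Bin Mul (bit_exp (Var 2) (Var 4)) (bit_exp (Var 3) (Var 4)))))
      \<rho> A = of_bool (set_decode (\<rho> 2) \<inter> set_decode (\<rho> 3) = {})"
    by auto
  then show ?thesis using assms by (simp add: valid_exp_def valid_def den_size of_bool_conj)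
qed

lemma den_rest:
  "\<rho> 3 < 2 ^ \<rho> 0 \<Longrightarrow> den rest_exp \<rho> A = A 2 (\<rho> 2 + \<rho> 3) -
     group_cost (\<lambda>i j. A 0 (i * \<rho> 1 + j)) (\<rho> 1) (set_decode (\<rho> 3))"
  by (simp add: rest_exp_def den_cost)

lemma den_extend:
  "den (extend_exp k) \<rho> A = extend k (\<lambda>i j. A 0 (i * \<rho> 1 + j)) (\<rho> 1) (\<rho> 0) (A 2) (\<rho> 2)"
proof -
  have "(\<lambda>T. den (Bin Mul (valid_exp k) rest_exp) (\<rho>(3 := T)) A) ` {..<2 ^ \<rho> 0} =
    (\<lambda>T. if valid k (\<rho> 2) T then A 2 (\<rho> 2 + T) -
      group_cost (\<lambda>i j. A 0 (i * \<rho> 1 + j)) (\<rho> 1) (set_decode T) else 0) ` {..<2 ^ \<rho> 0}"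
    by (intro image_cong) (simp_all add: den_valid den_rest)
  then show ?thesis by (simp add: extend_def extend_exp_def)
qed

lemma den_pick:
  "den (pick_exp k) \<rho> A = pick k (\<lambda>i j. A 0 (i * \<rho> 1 + j)) (\<rho> 1) (\<rho> 0) (A 2) (\<rho> 2)"
proof -
  have "(\<lambda>T. den (Bin Mul (Bin Mul (Var 3) (valid_exp k))
      (not_exp (differ_exp (Cell 2 (Var 2)) rest_exp))) (\<rho>(3 := T)) A) ` {..<2 ^ \<rho> 0} =
    (\<lambda>T. if valid k (\<rho> 2) T \<and> A 2 (\<rho> 2) = A 2 (\<rho> 2 + T) -
      group_cost (\<lambda>i j. A 0 (i * \<rho> 1 + j)) (\<rho> 1) (set_decode T) then T else 0) ` {..<2 ^ \<rho> 0}"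
    by (intro image_cong) (simp_all add: den_valid den_rest)
  then show ?thesis by (simp add: pick_def pick_exp_def)
qed

section \<open>Meaning of the three phases of the program\<close>

lemma countdown_induct:
  assumes "I N z" "\<And>i z. i < N \<Longrightarrow> I (Suc i) z \<Longrightarrow> I i (h i z)"
  shows "I 0 (countdown h N z)"
  using assms by (induction N arbitrary: z) auto

lemma hsem_fill:
  fixes A :: "nat \<Rightarrow> nat \<Rightarrow> nat"
  assumes "0 < k" "\<rho> 0 = n" "\<rho> 1 = m"
  defines "A' \<equiv> hsem (fill k) \<rho> A"
  shows "A' 0 = A 0 \<and> A' 3 = A 3 \<and> table k (\<lambda>i j. A 0 (i * m + j)) m n 0 (A' 2)"
proof -
  let ?E = "\<lambda>i j. A 0 (i * m + j)"
  define A1 where "A1 = hsem (Put 2 (Bin Sub (pow_exp (Var 0)) (Num 1))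
    (Bin Add (Bin Mul (Var 0) (Var 1)) (Num 1))) \<rho> A"
  define I where "I i A' \<longleftrightarrow> A' 0 = A 0 \<and> A' 3 = A 3 \<and> table k ?E m n i (A' 2)"
    for i and A' :: "nat \<Rightarrow> nat \<Rightarrow> nat"
  have A': "A' = countdown (\<lambda>i. hsem (Put 2 (Var 2) (extend_exp k)) (\<rho>(2 := i))) (2 ^ n - 1) A1"
    unfolding A'_def A1_def fill_def Let_def using assms by simp
  have "I 0 A'" unfolding A'
  proof (rule countdown_induct[where I = I])
    show "I (2 ^ n - 1) A1" unfolding I_def A1_def table_def using assms by simp
    fix i B assume i: "i < 2 ^ n - (1 :: nat)" and B: "I (Suc i) B"
    have "hsem (Put 2 (Var 2) (extend_exp k)) (\<rho>(2 := i)) B =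
      B(2 := (B 2)(i := extend k ?E m n (B 2) i))"
      using B assms unfolding I_def by (simp add: den_extend)
    then show "I i (hsem (Put 2 (Var 2) (extend_exp k)) (\<rho>(2 := i)) B)"
      using B table_step[of k ?E m n i "B 2"] assms i unfolding I_def by (simp del: fun_upd_apply) simp
  qed
  then show ?thesis unfolding I_def .
qed

lemma hsem_select:
  fixes A :: "nat \<Rightarrow> nat \<Rightarrow> nat"
  assumes "0 < k" "\<rho> 0 = n" "\<rho> 1 = m" and F: "table k (\<lambda>i j. A 0 (i * m + j)) m n 0 (A 2)" "0 < A 2 0"
    and "A 3 = (\<lambda>t. 0)"
  defines "A' \<equiv> hsem (select k) \<rho> A"
  shows "A' 0 = A 0 \<and> A' 2 = A 2 \<and> selection k (\<lambda>i j. A 0 (i * m + j)) m n (A 2) 0 (A' 3)"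
proof -
  let ?E = "\<lambda>i j. A 0 (i * m + j)"
  let ?P = "Bind 2 (Fold Sum 8 (Var 0) (Cell 3 (Var 8))) (Put 3 (Var 7) (pick_exp k))"
  define I where "I i A' \<longleftrightarrow> A' 0 = A 0 \<and> A' 2 = A 2 \<and> selection k ?E m n (A 2) i (A' 3)"
    for i and A' :: "nat \<Rightarrow> nat \<Rightarrow> nat"
  have A': "A' = countdown (\<lambda>i. hsem ?P (\<rho>(7 := i))) n A"
    unfolding A'_def select_def using assms by simp
  have "I 0 A'" unfolding A'
  proof (rule countdown_induct[where I = I])
    show "I n A" unfolding I_def using assms selection_init by simp
    fix i B assume i: "i < n" and B: "I (Suc i) B"
    have "hsem ?P (\<rho>(7 := i)) B = B(3 := (B 3)(i := pick k ?E m n (A 2) (\<Sum>t<n. B 3 t)))"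
      using B assms unfolding I_def by (simp add: den_pick)
    then show "I i (hsem ?P (\<rho>(7 := i)) B)"
      using B selection_step[OF F(1) assms(1) F(2) _ i, of "B 3"] unfolding I_def
      by (simp del: fun_upd_apply) simp
  qed
  then show ?thesis unfolding I_def .
qed

lemma hsem_emit:
  assumes "\<rho> 0 = n" "\<rho> 1 = m" and G: "\<And>t. t < n \<Longrightarrow> A 3 t < 2 ^ n" and "i < n" "j < m"
  shows "hsem emit \<rho> A 1 (i * m + j) = (\<Sum>t<n. of_bool (i \<in> set_decode (A 3 t) \<and>
    \<not> conflict (\<lambda>i j. A 0 (i * m + j)) (set_decode (A 3 t)) j) * A 0 (i * m + j))"
proof -
  define out where "out i j = (\<Sum>t<n. of_bool (i \<in> set_decode (A 3 t) \<and>
    \<not> conflict (\<lambda>i j. A 0 (i * m + j)) (set_decode (A 3 t)) j) * A 0 (i * m + j))" for i j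
  let ?e = "Fold Sum 7 (Var 0) (Bin Mul
        (Bin Mul (bit_exp (Cell 3 (Var 7)) (Var 10)) (uniform_exp (Cell 3 (Var 7))))
        (Cell 0 (pos_exp 10)))"
  let ?P = "Put 1 (pos_exp 10) ?e"
  let ?Q = "For 6 (Var 1) ?P"
  have P: "hsem ?P (\<rho>(10 := i, 6 := j)) B = B(1 := (B 1)(i * m + j := out i j))"
    if "B 0 = A 0" "B 3 = A 3" for B i j
  proof -
    have "den (uniform_exp (Cell 3 (Var 7))) (\<rho>(10 := i, 6 := j, 7 := t)) B =
      of_bool (\<not> conflict (\<lambda>i j. A 0 (i * m + j)) (set_decode (A 3 t)) j)" if "t < n" for t
      using \<open>B 0 = A 0\<close> \<open>B 3 = A 3\<close> assms(1,2) G[OF that] by (subst den_uniform[where T = "A 3 t"]) auto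
    then have "den ?e (\<rho>(10 := i, 6 := j)) B = out i j"
      unfolding out_def using that assms(1,2) by (simp add: of_bool_conj)
    then show ?thesis using assms(2) by simp
  qed
  define I where "I i B \<longleftrightarrow> B 0 = A 0 \<and> B 3 = A 3 \<and>
      (\<forall>i' j. i \<le> i' \<and> i' < n \<and> j < m \<longrightarrow> B 1 (i' * m + j) = out i' j)"
    for i and B :: "nat \<Rightarrow> nat \<Rightarrow> nat"
  have "I 0 (countdown (\<lambda>i. hsem ?Q (\<rho>(10 := i))) n A)"
  proof (rule countdown_induct[where I = I])
    show "I n A" unfolding I_def by simp
    fix i B assume i: "i < n" and B: "I (Suc i) B"
    \<comment> \<open>Inner invariant: the rows above \<open>i\<close> stay finished, and row
      \<open>i\<close> is finished from column \<open>j\<close> on.\<close>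
    define J where "J j B \<longleftrightarrow> I (Suc i) B \<and> (\<forall>j'. j \<le> j' \<and> j' < m \<longrightarrow> B 1 (i * m + j') = out i j')"
      for j and B :: "nat \<Rightarrow> nat \<Rightarrow> nat"
    have "J 0 (countdown (\<lambda>j. hsem ?P (\<rho>(10 := i, 6 := j))) m B)"
    proof (rule countdown_induct[where I = J])
      show "J m B" unfolding J_def using B by simp
      fix j C assume j: "j < m" and C: "J (Suc j) C"
      \<comment> \<open>Distinct entries have distinct row-major positions, so the store overwrites
        no finished entry.\<close>
      have inj: "i' * m + j' = i * m + j \<longleftrightarrow> i' = i \<and> j' = j" if "j' < m" for i' j'
      proof
        assume eq: "i' * m + j' = i * m + j"
        have "(i' * m + j') mod m = j'" "(i * m + j) mod m = j" using that j by simp_all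
        then have "j' = j" using eq by simp
        then show "i' = i \<and> j' = j" using eq j by simp
      qed simp
      have C': "C 0 = A 0" "C 3 = A 3" using C unfolding J_def I_def by auto
      show "J j (hsem ?P (\<rho>(10 := i, 6 := j)) C)"
        unfolding P[OF C'] J_def I_def
      proof (intro conjI allI impI)
        fix i' j' assume ij': "Suc i \<le> i' \<and> i' < n \<and> j' < m"
        then have "C 1 (i' * m + j') = out i' j'" using C unfolding J_def I_def by blast
        then show "(C(1 := (C 1)(i * m + j := out i j))) 1 (i' * m + j') = out i' j'"
          using inj[of j' i'] ij' by simp
      next
        fix j' assume j': "j \<le> j' \<and> j' < m"
        then have "C 1 (i * m + j') = out i j'" if "j' \<noteq> j"
          using C that unfolding J_def by (metis Suc_leI le_neq_implies_less)
        then show "(C(1 := (C 1)(i * m + j := out i j))) 1 (i * m + j') = out i j'"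
          using inj[of j' i] j' by (cases "j' = j") auto
      qed (use C' in simp_all)
    qed
    moreover have "hsem ?Q (\<rho>(10 := i)) B = countdown (\<lambda>j. hsem ?P (\<rho>(10 := i, 6 := j))) m B"
      using assms(2) by simp
    ultimately have Q: "J 0 (hsem ?Q (\<rho>(10 := i)) B)" by (simp only:)
    show "I i (hsem ?Q (\<rho>(10 := i)) B)"
      unfolding I_def
    proof (intro conjI allI impI)
      fix i' j assume "i \<le> i' \<and> i' < n \<and> j < m"
      then show "hsem ?Q (\<rho>(10 := i)) B 1 (i' * m + j) = out i' j"
        using Q Suc_leI[of i i'] unfolding J_def I_def by (cases "i' = i") (blast, simp del: hsem.simps)
    qed (use Q in \<open>simp_all only: J_def I_def\<close>)
  qed
  moreover have "hsem emit \<rho> A = countdown (\<lambda>i. hsem ?Q (\<rho>(10 := i))) n A"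
    unfolding emit_def using assms(1) by simp
  ultimately show ?thesis unfolding I_def out_def using assms(4,5) by simp
qed

section \<open>Growth rates\<close>

text \<open>\<open>c\<close> counts the factors \<open>2 ^ n\<close>. The sum
  \<open>m + floorlog 2 \<sigma>\<close> is a single argument so that one polynomial handles both
  the number of columns and the letter length.\<close>

definition growth :: "nat \<Rightarrow> (nat \<Rightarrow> nat \<Rightarrow> nat \<Rightarrow> nat) \<Rightarrow> bool" where
  "growth c g \<longleftrightarrow> (\<exists>p q :: nat poly. \<forall>n m \<sigma>.
     g n m \<sigma> \<le> 2 ^ (c * n) * poly p n * poly q (m + floorlog 2 \<sigma>))"

lemma growthI:
  "(\<And>n m \<sigma>. g n m \<sigma> \<le> 2 ^ (c * n) * poly p n * poly q (m + floorlog 2 \<sigma>)) \<Longrightarrow> growth c g"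
  unfolding growth_def by blast

lemma growth_mono: "growth c g \<Longrightarrow> (\<And>n m \<sigma>. f n m \<sigma> \<le> g n m \<sigma>) \<Longrightarrow> growth c f"
  unfolding growth_def by (meson order_trans)

lemma growth_const: "growth c (\<lambda>n m \<sigma>. K)"
  by (rule growthI[where p = "[:K:]" and q = "[:1:]"]) simp

lemma growth_rows: "growth c (\<lambda>n m \<sigma>. n)"
  by (rule growthI[where p = "[:0, 1:]" and q = "[:1:]"]) simp

lemma growth_cols: "growth c (\<lambda>n m \<sigma>. m + floorlog 2 \<sigma>)"
  by (rule growthI[where p = "[:1:]" and q = "[:0, 1:]"]) simp

text \<open>Over the naturals \<open>(p + p') * (q + q')\<close> dominates
  \<open>p * q + p' * q'\<close>, the mixed terms being nonnegative.\<close>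

lemma growth_add:
  assumes "growth c f" "growth c g"
  shows "growth c (\<lambda>n m \<sigma>. f n m \<sigma> + g n m \<sigma>)"
proof -
  obtain p q p' q' :: "nat poly" where
    pq: "\<And>n m \<sigma>. f n m \<sigma> \<le> 2 ^ (c * n) * poly p n * poly q (m + floorlog 2 \<sigma>)"
    "\<And>n m \<sigma>. g n m \<sigma> \<le> 2 ^ (c * n) * poly p' n * poly q' (m + floorlog 2 \<sigma>)"
    using assms unfolding growth_def by metis
  have "f n m \<sigma> + g n m \<sigma> \<le> 2 ^ (c * n) * poly (p + p') n * poly (q + q') (m + floorlog 2 \<sigma>)" for n m \<sigma>
    by (rule order_trans[OF add_mono[OF pq]]) (simp add: algebra_simps)
  then show ?thesis by (rule growthI)
qed

lemma growth_mult:
  assumes "growth c f" "growth d g"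
  shows "growth (c + d) (\<lambda>n m \<sigma>. f n m \<sigma> * g n m \<sigma>)"
proof -
  obtain p q p' q' :: "nat poly" where
    pq: "\<And>n m \<sigma>. f n m \<sigma> \<le> 2 ^ (c * n) * poly p n * poly q (m + floorlog 2 \<sigma>)"
    "\<And>n m \<sigma>. g n m \<sigma> \<le> 2 ^ (d * n) * poly p' n * poly q' (m + floorlog 2 \<sigma>)"
    using assms unfolding growth_def by metis
  have "f n m \<sigma> * g n m \<sigma> \<le> 2 ^ ((c + d) * n) * poly (p * p') n * poly (q * q') (m + floorlog 2 \<sigma>)" for n m \<sigma>
    using mult_le_mono[OF pq(1)[of n m \<sigma>] pq(2)[of n m \<sigma>]]
    by (simp add: algebra_simps power_add)
  then show ?thesis by (rule growthI)
qed

lemma growth_pow: "growth (Suc 0) (\<lambda>n m \<sigma>. 2 ^ n)"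
  by (rule growthI[where p = "[:1:]" and q = "[:1:]"]) simp

lemma growth_mult_poly: "growth 0 f \<Longrightarrow> growth c g \<Longrightarrow> growth c (\<lambda>n m \<sigma>. f n m \<sigma> * g n m \<sigma>)"
  using growth_mult[of 0 f c g] by simp

lemma growth_mult_pow: "growth c f \<Longrightarrow> growth (Suc c) (\<lambda>n m \<sigma>. 2 ^ n * f n m \<sigma>)"
  using growth_mult[OF growth_pow, of c f] by simp

lemma growth_m: "growth c (\<lambda>n m \<sigma>. m)"
  by (rule growth_mono[OF growth_cols]) simp

text \<open>A bound of exponent 2 is reduced by removing one outer factor \<open>2 ^ n\<close> at a
  time, through exponent 1 down to a polynomial.\<close>

lemmas growth_mult_pows = growth_mult_pow[of 0] growth_mult_pow[of "Suc 0", folded numeral_2_eq_2]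

lemma growth_Suc: "growth c f \<Longrightarrow> growth c (\<lambda>n m \<sigma>. Suc (f n m \<sigma>))"
  using growth_add[OF _ growth_const[of c 1], of f] by simp

section \<open>Binary lengths\<close>

lemma size_of_less: "x < 2 ^ e \<Longrightarrow> 0 < e \<Longrightarrow> size_of x \<le> e"
  unfolding size_of_def using floorlog_leI[of x 2 e] by auto

lemma less_pow_size_of: "x < 2 ^ size_of x"
  using floorlog_bounds[of x 2] power_increasing[of "floorlog 2 x" "size_of x" "2 :: nat"]
  unfolding size_of_def by (cases "x = 0") (auto intro: less_le_trans)

lemma size_of_mult: "size_of (x * y) \<le> size_of x + size_of y"
proof (rule size_of_less)
  show "x * y < 2 ^ (size_of x + size_of y)"
    unfolding power_add by (intro mult_strict_mono less_pow_size_of) auto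
qed (use size_of_ge_1[of x] in simp)

lemma size_of_add: "size_of (x + y) \<le> size_of x + size_of y"
proof (rule size_of_less)
  obtain a b where ab: "size_of x = Suc a" "size_of y = Suc b"
    using size_of_ge_1[of x] size_of_ge_1[of y] by (metis Suc_le_D One_nat_def)
  have "x + y < 2 ^ Suc a + 2 ^ Suc b"
    using less_pow_size_of[of x] less_pow_size_of[of y] unfolding ab by linarith
  \<comment> \<open>Both lengths are at least 1, so writing them as successors leaves room for the
    carry of the sum.\<close>
  also have "(2 :: nat) ^ a \<le> 2 ^ (a + b)" "(2 :: nat) ^ b \<le> 2 ^ (a + b)" by simp_all
  then have "(2 :: nat) ^ Suc a + 2 ^ Suc b \<le> 2 ^ Suc (Suc (a + b))" unfolding power_Suc by linarith
  finally show "x + y < 2 ^ (size_of x + size_of y)" unfolding ab by simp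
qed (use size_of_ge_1[of x] in simp)

lemma size_of_le_Suc: "size_of x \<le> Suc x"
  by (rule size_of_less) (auto intro: less_trans[OF less_exp])

lemma growth_size_add:
  "growth 0 (\<lambda>n m \<sigma>. size_of (f n m \<sigma>)) \<Longrightarrow> growth 0 (\<lambda>n m \<sigma>. size_of (g n m \<sigma>)) \<Longrightarrow>
   growth 0 (\<lambda>n m \<sigma>. size_of (f n m \<sigma> + g n m \<sigma>))"
  by (rule growth_mono[OF growth_add[where g = "\<lambda>n m \<sigma>. size_of (g n m \<sigma>)"]]) (auto intro: size_of_add)

lemma growth_size_mult:
  "growth 0 (\<lambda>n m \<sigma>. size_of (f n m \<sigma>)) \<Longrightarrow> growth 0 (\<lambda>n m \<sigma>. size_of (g n m \<sigma>)) \<Longrightarrow>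
   growth 0 (\<lambda>n m \<sigma>. size_of (f n m \<sigma> * g n m \<sigma>))"
  by (rule growth_mono[OF growth_add[where g = "\<lambda>n m \<sigma>. size_of (g n m \<sigma>)"]]) (auto intro: size_of_mult)

lemma growth_size_Suc:
  "growth 0 (\<lambda>n m \<sigma>. size_of (f n m \<sigma>)) \<Longrightarrow> growth 0 (\<lambda>n m \<sigma>. size_of (Suc (f n m \<sigma>)))"
  using growth_size_add[OF _ growth_const[of 0 "size_of 1"], of f] by simp

lemma growth_size_rows: "growth 0 (\<lambda>n m \<sigma>. size_of n)"
  by (rule growth_mono[OF growth_Suc[OF growth_rows]]) (rule size_of_le_Suc)

lemma growth_size_m: "growth 0 (\<lambda>n m \<sigma>. size_of m)"
  by (rule growth_mono[OF growth_Suc[OF growth_m]]) (rule size_of_le_Suc)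

text \<open>Subset codes are exponentially large but have about \<open>n\<close> digits; this keeps
  the logarithmic cost at exponent 0.\<close>

lemma growth_size_pow: "growth 0 (\<lambda>n m \<sigma>. size_of (2 ^ n))"
  by (rule growth_mono[OF growth_Suc[OF growth_rows]]) (auto intro: size_of_less)

lemma growth_size_alphabet: "growth 0 (\<lambda>n m \<sigma>. size_of \<sigma>)"
  by (rule growth_mono[OF growth_Suc[OF growth_cols]]) (simp add: size_of_def)

lemmas growth_intros = growth_const growth_rows growth_m growth_size_rows growth_size_m growth_size_pow
  growth_size_alphabet growth_pow growth_add growth_Suc growth_mult_pows growth_mult_poly growth_size_add
  growth_size_mult growth_size_Suc

section \<open>Resource bounds\<close>

text \<open>Used both as the initial environment and as the bound on it. All variables except 1 have
  the value \<open>n\<close> because they are initially mapped to register 0.\<close>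

definition dim_bound :: "nat \<Rightarrow> nat \<Rightarrow> nat \<Rightarrow> nat" where
  "dim_bound n m = (\<lambda>x. if x = 1 then m else n)"

text \<open>Letters below \<open>\<sigma>\<close> have codes up to \<open>\<sigma>\<close>. The
  generous value for the output is what \<open>bound\<close> yields for \<open>emit\<close>: a
  truncated difference is bounded by its minuend, so a single bit of a group code counts as
  \<open>2 ^ n\<close>.\<close>

definition cell_bound :: "nat \<Rightarrow> nat \<Rightarrow> nat \<Rightarrow> nat \<Rightarrow> nat" where
  "cell_bound n m \<sigma> = (\<lambda>a. if a = 0 then \<sigma> else if a = 1 then n * (2 ^ n * \<sigma>)
     else if a = 2 then n * m + 1 else if a = 3 then 2 ^ n else 0)"

lemmas exp_defs = pow_exp_def bit_exp_def size_exp_def not_exp_def differ_exp_def pos_exp_def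
  uniform_exp_def cost_exp_def valid_exp_def rest_exp_def extend_exp_def pick_exp_def
  fill_def select_def emit_def solve_def dim_bound_def cell_bound_def Let_def

lemma well_bounded_solve: "well_bounded (solve k) (dim_bound n m) (cell_bound n m \<sigma>)"
  by (simp add: exp_defs flip: numeral_2_eq_2)

text \<open>Exponent 2 comes from filling the table: the loop over \<open>S\<close> contains the
  maximum over \<open>T\<close>. The other phases have at most one loop of exponential
  length.\<close>

lemma growth_steps: "growth 2 (\<lambda>n m \<sigma>. prog_steps (solve k) (dim_bound n m) (cell_bound n m \<sigma>))"
  by (simp add: exp_defs flip: numeral_2_eq_2) (intro growth_intros)

lemma growth_bits: "growth 0 (\<lambda>n m \<sigma>. prog_bits (solve k) (dim_bound n m) (cell_bound n m \<sigma>))"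
  by (simp add: exp_defs flip: numeral_2_eq_2) (intro growth_intros)

lemma input_state_regs: "D \<in> carrier_mat n m \<Longrightarrow>
    regs (input_state D) (if x = 1 then 1 else 0) = dim_bound n m x"
  by (auto simp: input_state_def dim_bound_def)

lemma input_state_entry:
  assumes D: "D \<in> carrier_mat n m" and "i < n" "j < m"
  shows "arrs (input_state D) 0 (i * m + j) = code (Some (D $$ (i, j)))"
proof -
  have "i * m + j < n * m"
    using assms mult_le_mono1[of "Suc i" n m] by simp
  then show ?thesis using assms by (simp add: input_state_def)
qed

lemma input_state_cells:
  assumes D: "D \<in> carrier_mat n m" and \<sigma>: "elements_mat D \<subseteq> {..<\<sigma>}"
  shows "arrs (input_state D) a l \<le> cell_bound n m \<sigma> a"
proof (cases "a = 0 \<and> l < n * m")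
  case True
  then have "0 < m" by (cases m) auto
  then have "l div m < n" "l mod m < m" using True by (simp_all add: less_mult_imp_div_less)
  then have "D $$ (l div m, l mod m) \<in> elements_mat D" using D unfolding elements_mat_def by force
  then have "D $$ (l div m, l mod m) < \<sigma>" using \<sigma> by auto
  then show ?thesis using D True by (simp add: input_state_def cell_bound_def)
next
  case False
  then show ?thesis using D by (auto simp: input_state_def)
qed

lemma outputs_solve:
  assumes D: "D \<in> carrier_mat n m" and k: "0 < k" and B: "k_anonymization k D B"
    and s: "arrs s = hsem (solve k) (dim_bound n m) (arrs (input_state D))"
  shows "\<exists>B. optimal_k_anonymization k D B \<and> outputs s B"
proof -
  let ?A = "arrs (input_state D)" and ?\<rho> = "dim_bound n m"
  let ?E = "\<lambda>i j. ?A 0 (i * m + j)"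
  note E = input_state_entry[OF D]
  have \<rho>: "?\<rho> 0 = n" "?\<rho> 1 = m" by (simp_all add: dim_bound_def)
  define A1 where "A1 = hsem (fill k) ?\<rho> ?A"
  define A2 where "A2 = hsem (select k) ?\<rho> A1"
  have A1: "A1 0 = ?A 0" "A1 3 = ?A 3" "table k ?E m n 0 (A1 2)"
    using hsem_fill[of k ?\<rho> n m ?A] k \<rho> unfolding A1_def by auto
  \<comment> \<open>The given anonymization makes the instance feasible, which the reconstruction
    relies on.\<close>
  have "0 < A1 2 0" by (rule table_pos[OF D k E A1(3) B])
  then have A2: "A2 0 = ?A 0" "selection k ?E m n (A1 2) 0 (A2 3)"
    using hsem_select[of k ?\<rho> n m A1] k \<rho> A1 unfolding A2_def by (simp_all add: input_state_def)
  let ?P = "\<lambda>t. set_decode (A2 3 t)"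
  define B' where "B' = mat n m (\<lambda>(i, j). if \<exists>t<n. i \<in> ?P t \<and> conflict ?E (?P t) j then None
    else Some (D $$ (i, j)))"
  have lt: "A2 3 t < 2 ^ n" if "t < n" for t
    using A2(2) member_le_sum[of t "{..<n}" "A2 3"] that unfolding selection_def by simp
  have "arrs s 1 (i * m + j) = code (B' $$ (i, j))" if ij: "i < n" "j < m" for i j
  proof -
    obtain t where t: "t < n" "i \<in> ?P t" using selection_full(1)[OF A2(2)] ij(1) by blast
    have uniq: "i \<notin> ?P t'" if "t' < n" "t' \<noteq> t" for t'
      using A2(2) t that unfolding selection_def disjoint_family_on_def by blast
    have "arrs s 1 (i * m + j) =
      (\<Sum>t<n. of_bool (i \<in> ?P t \<and> \<not> conflict ?E (?P t) j) * ?E i j)"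
      using hsem_emit[of ?\<rho> n m A2 i j, OF \<rho> lt ij] unfolding s solve_def
      by (simp add: A1_def[symmetric] A2_def[symmetric] A2(1))
    \<comment> \<open>Only the unique group containing row \<open>i\<close> contributes to the
      sum.\<close>
    also have "\<dots> = of_bool (\<not> conflict ?E (?P t) j) * ?E i j"
      using t uniq by (subst sum.remove[of _ t]) auto
    also have "\<dots> = code (B' $$ (i, j))"
    proof -
      have "(\<exists>t'<n. i \<in> ?P t' \<and> conflict ?E (?P t') j) \<longleftrightarrow> conflict ?E (?P t) j"
        using t uniq by blast
      then show ?thesis using ij E[OF ij] unfolding B'_def by simp
    qed
    finally show ?thesis .
  qed
  then have "outputs s B'" unfolding outputs_def by (simp add: B'_def)
  moreover have "optimal_k_anonymization k D B'"
    unfolding B'_def by (rule optimal_of_selection[OF D k E A1(3) A2(2)])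
  ultimately show ?thesis by blast
qed

theorem theorem3:
  fixes k :: nat
  assumes "k > 1"
  shows "\<exists>(P :: prog) (p :: nat poly) (q :: nat poly).
           \<forall>(n :: nat) (m :: nat) (\<sigma> :: nat) (D :: nat mat).
             D \<in> carrier_mat n m \<and> elements_mat D \<subseteq> {..<\<sigma>} \<longrightarrow>
             computes_within P k D (4 ^ n * poly p n * poly q (m + floorlog 2 \<sigma>))"
proof -
  have k: "0 < k" using assms by simp
  \<comment> \<open>The dimensions are already in registers 0 and 1, so register 2 is the first one
    available for intermediate values. The constant \<open>k\<close> is built into the
    program.\<close>
  let ?\<Gamma> = "\<lambda>x. if x = 1 then 1 else 0 :: nat"
  let ?P = "compile_prog ?\<Gamma> 2 (solve k)"
  let ?T = "\<lambda>n m \<sigma>. prog_steps (solve k) (dim_bound n m) (cell_bound n m \<sigma>) *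
    (6 * prog_bits (solve k) (dim_bound n m) (cell_bound n m \<sigma>))"
  \<comment> \<open>Steps contribute exponent 2 and the cost of a single step exponent 0;
    \<open>2 ^ (2 * n)\<close> later becomes \<open>4 ^ n\<close>.\<close>
  have "growth (2 + 0) ?T"
    by (intro growth_mult[OF growth_steps] growth_mult_poly growth_const growth_bits)
  then obtain p q :: "nat poly" where
    T: "\<And>n m \<sigma>. ?T n m \<sigma> \<le> 2 ^ (2 * n) * poly p n * poly q (m + floorlog 2 \<sigma>)"
    unfolding growth_def by auto
  have "computes_within ?P k D (4 ^ n * poly p n * poly q (m + floorlog 2 \<sigma>))"
    if D: "D \<in> carrier_mat n m" "elements_mat D \<subseteq> {..<\<sigma>}" for n m \<sigma> D
  proof -
    have "exec ?P (input_state D) (?T n m \<sigma>) (\<lambda>s'.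
      arrs s' = hsem (solve k) (\<lambda>x. regs (input_state D) (?\<Gamma> x)) (arrs (input_state D)) \<and>
      (\<forall>r<2. regs s' r = regs (input_state D) r))"
      by (rule exec_compile_prog)
        (simp_all only: input_state_regs[OF D(1)] input_state_cells[OF D] well_bounded_solve, simp_all)
    then obtain t s where ts: "runs ?P (input_state D) t s" "t \<le> ?T n m \<sigma>"
      "arrs s = hsem (solve k) (dim_bound n m) (arrs (input_state D))"
      unfolding exec_def input_state_regs[OF D(1)] by blast
    have "t \<le> 4 ^ n * poly p n * poly q (m + floorlog 2 \<sigma>)"
      using ts(2) T[of n m \<sigma>] by (simp add: power_mult)
    then show ?thesis
      unfolding computes_within_def using ts(1) outputs_solve[OF D(1) k _ ts(3)] by blast
  qed
  then show ?thesis by blast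
qed

end
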